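(* Let $k$ be a field, let $G$ be a finite simple graph on vertex set $V=\{x_1,\dots,x_n\}$, let $R=k[x_1,\dots,x_n]$ and let $I=I(G)\subseteq R$ be its edge ideal. Then $\operatorname{reg}(R/I)\le\zeta(G)$.
   Context: The edge ideal is $I(G)=(x_ix_j:\{x_i,x_j\}\text{ an edge of }G)$. For a vertex $x$, $N_G[x]$ is the set consisting of $x$ and its neighbours, and for $S\subseteq V$, $N_G[S]=\bigcup_{x\in S}N_G[x]$. A maximal center-separated packing of nondegenerate stars is a set $S$ of vertices such that every vertex of $S$ has degree at least $2$, $S$ is independent (no two vertices of $S$ adjacent), and $S$ is maximal by inclusion among independent sets of vertices of degree at least $2$ (equivalently, no vertex outside $N_G[S]$ has degree at least $2$ in $G$). For such $S$, the induced subgraph $G\setminus N_G[S]$ on $V\setminus N_G[S]$ consists of pairwise disjoint edges and isolated vertices; set $\zeta_S=|S|+(\text{number of edges of }G\setminus N_G[S])$. Then $\zeta(G)$ is the maximum of $\zeta_S$ over all such $S$. $\operatorname{reg}$ is Castelnuovo–Mumford regularity over $R$. *)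

theory Defs
  imports
    "HOL-Library.Poly_Mapping"
    "HOL-Library.Extended_Real"
    "Jordan_Normal_Form.Matrix_Kernel"
begin

text \<open>
  The variables of the polynomial ring are the elements of a finite type \<^typ>\<open>'v\<close>, which is also
  the vertex set of the graph. A monomial is an exponent vector \<open>'v \<Rightarrow>\<^sub>0 nat\<close>, and the
  multiplication of \<open>('v \<Rightarrow>\<^sub>0 nat) \<Rightarrow>\<^sub>0 'k\<close> is the convolution product, so this type is the full
  polynomial ring over \<^typ>\<open>'k\<close>.
\<close>

type_synonym ('v, 'k) mpoly = "('v \<Rightarrow>\<^sub>0 nat) \<Rightarrow>\<^sub>0 'k"

text \<open>A simple graph on the vertex set \<^term>\<open>UNIV :: 'v set\<close>, given by its set of edges.\<close>

definition simple_graph :: "'v set set \<Rightarrow> bool" where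
  "simple_graph E \<longleftrightarrow> (\<forall>e\<in>E. card e = 2)"

definition neighbors :: "'v set set \<Rightarrow> 'v \<Rightarrow> 'v set" where
  "neighbors E x = {y. {x, y} \<in> E}"

definition vertex_degree :: "'v set set \<Rightarrow> 'v \<Rightarrow> nat" where
  "vertex_degree E x = card (neighbors E x)"

definition closed_nbhd :: "'v set set \<Rightarrow> 'v set \<Rightarrow> 'v set" where
  "closed_nbhd E S = (\<Union>x\<in>S. insert x (neighbors E x))"

definition independent_set :: "'v set set \<Rightarrow> 'v set \<Rightarrow> bool" where
  "independent_set E S \<longleftrightarrow> (\<forall>x\<in>S. \<forall>y\<in>S. {x, y} \<notin> E)"

definition star_packing :: "'v set set \<Rightarrow> 'v set \<Rightarrow> bool" where
  "star_packing E S \<longleftrightarrow> (\<forall>x\<in>S. vertex_degree E x \<ge> 2) \<and> independent_set E S"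

definition maximal_star_packing :: "'v set set \<Rightarrow> 'v set \<Rightarrow> bool" where
  "maximal_star_packing E S \<longleftrightarrow>
     star_packing E S \<and> (\<forall>T. star_packing E T \<and> S \<subseteq> T \<longrightarrow> T = S)"

definition induced_edges :: "'v set set \<Rightarrow> 'v set \<Rightarrow> 'v set set" where
  "induced_edges E W = {e \<in> E. e \<subseteq> W}"

definition zeta_at :: "'v set set \<Rightarrow> 'v set \<Rightarrow> nat" where
  "zeta_at E S = card S + card (induced_edges E (UNIV - closed_nbhd E S))"

definition zeta :: "'v::finite set set \<Rightarrow> nat" where
  "zeta E = Max {zeta_at E S | S. maximal_star_packing E S}"

definition Var :: "'v \<Rightarrow> ('v, 'k::comm_ring_1) mpoly" where
  "Var x = Poly_Mapping.single (Poly_Mapping.single x 1) 1"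

definition ideal_generated :: "'r::comm_ring_1 set \<Rightarrow> 'r set" where
  "ideal_generated B = Modules.module.span (*) B"

definition edge_ideal :: "'v set set \<Rightarrow> ('v, 'k::comm_ring_1) mpoly set" where
  "edge_ideal E = ideal_generated {Var x * Var y | x y. {x, y} \<in> E}"

definition monomial_degree :: "('v::finite \<Rightarrow>\<^sub>0 nat) \<Rightarrow> nat" where
  "monomial_degree m = (\<Sum>x\<in>UNIV. Poly_Mapping.lookup m x)"

text \<open>The zero polynomial is homogeneous of every degree, and the only one of negative degree.\<close>

definition homogeneous :: "int \<Rightarrow> ('v::finite, 'k::comm_ring_1) mpoly \<Rightarrow> bool" where
  "homogeneous a p \<longleftrightarrow> (\<forall>m\<in>Poly_Mapping.keys p. int (monomial_degree m) = a)"

text \<open>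
  A graded free resolution of \<open>R/I\<close> by finitely generated modules
  \[ \cdots \to F_2 \to F_1 \to F_0 \to R/I \to 0. \]
  The list \<open>b i\<close> contains the degrees, with multiplicity, of the basis elements of \<open>F\<^sub>i\<close>, that is,
  \<open>F\<^sub>i = \<Oplus>\<^sub>s R(-b i ! s)\<close>; the matrix \<open>D i\<close> represents the differential \<open>F\<^sub>i\<^sub>+\<^sub>1 \<rightarrow> F\<^sub>i\<close>. The augmentation
  \<open>F\<^sub>0 \<rightarrow> R/I\<close> is given by representatives \<open>\<epsilon> $ s\<close> in \<open>R\<close> of the images of the basis elements of
  \<open>F\<^sub>0\<close>, so it sends \<open>v\<close> to the class of \<open>\<epsilon> \<bullet> v\<close> modulo \<open>I\<close>. Homogeneity of the entries says that
  all maps have degree 0.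
\<close>

definition graded_free_resolution ::
  "('v::finite, 'k::comm_ring_1) mpoly set \<Rightarrow> (nat \<Rightarrow> int list) \<Rightarrow>
   ('v, 'k) mpoly vec \<Rightarrow> (nat \<Rightarrow> ('v, 'k) mpoly mat) \<Rightarrow> bool"
where
  "graded_free_resolution I b \<epsilon> D \<longleftrightarrow>
     \<epsilon> \<in> carrier_vec (length (b 0)) \<and>
     (\<forall>s<length (b 0). homogeneous (b 0 ! s) (\<epsilon> $ s)) \<and>
     (\<forall>i. D i \<in> carrier_mat (length (b i)) (length (b (Suc i)))) \<and>
     (\<forall>i. \<forall>t<length (b i). \<forall>s<length (b (Suc i)).
        homogeneous (b (Suc i) ! s - b i ! t) (D i $$ (t, s))) \<and>
     \<comment> \<open>exactness at \<open>R/I\<close>, at \<open>F\<^sub>0\<close>, and at \<open>F\<^sub>i\<^sub>+\<^sub>1\<close>\<close>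
     (\<forall>p. \<exists>v\<in>carrier_vec (length (b 0)). p - \<epsilon> \<bullet> v \<in> I) \<and>
     {v \<in> carrier_vec (length (b 0)). \<epsilon> \<bullet> v \<in> I} =
       (\<lambda>w. D 0 *\<^sub>v w) ` carrier_vec (length (b 1)) \<and>
     (\<forall>i. mat_kernel (D i) = (\<lambda>w. D (Suc i) *\<^sub>v w) ` carrier_vec (length (b (Suc (Suc i)))))"

text \<open>Minimality: the image of every differential lies in \<open>\<mm> F\<^sub>i\<close>, where \<open>\<mm>\<close> is generated by the variables.\<close>

definition minimal_graded_free_resolution ::
  "('v::finite, 'k::comm_ring_1) mpoly set \<Rightarrow> (nat \<Rightarrow> int list) \<Rightarrow>
   ('v, 'k) mpoly vec \<Rightarrow> (nat \<Rightarrow> ('v, 'k) mpoly mat) \<Rightarrow> bool"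
where
  "minimal_graded_free_resolution I b \<epsilon> D \<longleftrightarrow>
     graded_free_resolution I b \<epsilon> D \<and>
     (\<forall>i. \<forall>t<length (b i). \<forall>s<length (b (Suc i)).
        D i $$ (t, s) \<in> ideal_generated (range Var))"

text \<open>
  \<open>reg(R/I) = max {j - i | \<beta>\<^sub>i\<^sub>,\<^sub>j(R/I) \<noteq> 0}\<close> for a homogeneous ideal \<open>I\<close>, where the graded Betti number
  \<open>\<beta>\<^sub>i\<^sub>,\<^sub>j\<close> is the number of basis elements of degree \<open>j\<close> in the \<open>i\<close>-th module of a minimal graded free
  resolution of \<open>R/I\<close>. Over a field, such a resolution exists and is unique up to isomorphism, so the
  supremum over all of them below is the value for any one of them. The value is \<open>-\<infinity>\<close> for \<open>R/I = 0\<close>.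
\<close>

definition reg_quotient :: "('v::finite, 'k::field) mpoly set \<Rightarrow> ereal" where
  "reg_quotient I =
     Sup {ereal (of_int (j - int i)) | i j.
       \<exists>b \<epsilon> D. minimal_graded_free_resolution I b \<epsilon> D \<and> j \<in> set (b i)}"

end

theory Submission
  imports Defs
begin

text \<open>
  Regularity is measured by Koszul homology: \<open>reg(R/I) \<le> r\<close> as soon as the Koszul homology of \<open>R/I\<close>
  vanishes in internal degrees greater than \<open>r\<close>, because a basis element of degree \<open>j\<close> in the \<open>i\<close>-th
  module of a minimal resolution leads, by a zigzag through the double complex of the Koszul complex
  and the resolution, to a nonzero Koszul class of internal degree \<open>j - i\<close>.

  The vanishing is proved by induction on the number of edges. For a vertex \<open>x\<close> of degree at least two
  (or an end of an isolated edge, if there is none), the sequence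
  \<open>0 \<rightarrow> R/(I:x)(-1) \<rightarrow> R/I \<rightarrow> R/(I,x) \<rightarrow> 0\<close> bounds the regularity of \<open>G\<close> by the maximum of those of
  \<open>G \<setminus> N[x]\<close> plus one and \<open>G \<setminus> x\<close>, up to adding variables to the ideals. Correspondingly,
  \<open>\<zeta>(G) \<ge> \<zeta>(G \<setminus> N[x]) + 1\<close> and \<open>\<zeta>(G) \<ge> \<zeta>(G \<setminus> x)\<close>.
\<close>

subsection \<open>Coefficients and monomial ideals\<close>

abbreviation vm :: "'v \<Rightarrow> 'v \<Rightarrow>\<^sub>0 nat" where
  "vm x \<equiv> Poly_Mapping.single x 1"

lemma vm_add_diff: "0 < Poly_Mapping.lookup m x \<Longrightarrow> vm x + (m - vm x) = m"
  by (rule poly_mapping_eqI) (auto simp: lookup_add lookup_minus lookup_single when_def)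

text \<open>Subtraction of exponents is truncated, so \<open>m - vm x\<close> is a genuine quotient
  of monomials only when \<open>x\<close> divides \<open>m\<close>; hence the case
  distinction.\<close>

lemma lookup_Var_mult:
  "Poly_Mapping.lookup (Var x * p) m =
     (if 0 < Poly_Mapping.lookup m x then Poly_Mapping.lookup p (m - vm x) else 0)"
proof -
  have "Poly_Mapping.lookup (Var x * p) m =
      (\<Sum>q. Poly_Mapping.lookup p q when m = vm x + q)"
    unfolding Var_def lookup_mult lookup_single when_mult
    by (subst Sum_any_when_equal') simp
  also have "\<dots> = (if 0 < Poly_Mapping.lookup m x then Poly_Mapping.lookup p (m - vm x) else 0)"
  proof (cases "0 < Poly_Mapping.lookup m x")
    case True
    then have "m = vm x + q \<longleftrightarrow> m - vm x = q" for q
      by (metis add_diff_cancel_left' vm_add_diff)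
    then show ?thesis
      using True by simp
  next
    case False
    then have "m \<noteq> vm x + q" for q
      using False by (auto simp: lookup_add)
    then show ?thesis
      using False by simp
  qed
  finally show ?thesis .
qed

lemma lookup_sign_mult:
  "Poly_Mapping.lookup ((-1) ^ n * p :: ('v, 'k::comm_ring_1) mpoly) m =
     (-1) ^ n * Poly_Mapping.lookup p m"
  by (induction n) (simp_all add: mult.assoc)

lemma keys_uminus: "Poly_Mapping.keys (- p) = Poly_Mapping.keys (p :: 'a \<Rightarrow>\<^sub>0 'b::ab_group_add)"
  by (auto simp: in_keys_iff)

lemma keys_sign_mult:
  "Poly_Mapping.keys ((-1) ^ n * p :: ('v, 'k::comm_ring_1) mpoly) = Poly_Mapping.keys p"
  by (induction n) (simp_all add: mult.assoc keys_uminus)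

lemma keys_Var_mult: "Poly_Mapping.keys (Var x * p) = (+) (vm x) ` Poly_Mapping.keys p"
proof -
  have "m \<in> Poly_Mapping.keys (Var x * p) \<longleftrightarrow> m \<in> (+) (vm x) ` Poly_Mapping.keys p" for m
  proof
    assume "m \<in> Poly_Mapping.keys (Var x * p)"
    then have "0 < Poly_Mapping.lookup m x" "m - vm x \<in> Poly_Mapping.keys p"
      by (auto simp: in_keys_iff lookup_Var_mult split: if_splits)
    then show "m \<in> (+) (vm x) ` Poly_Mapping.keys p"
      by (metis image_eqI vm_add_diff)
  next
    assume "m \<in> (+) (vm x) ` Poly_Mapping.keys p"
    then show "m \<in> Poly_Mapping.keys (Var x * p)"
      by (auto simp: in_keys_iff lookup_Var_mult lookup_add)
  qed
  then show ?thesis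
    by blast
qed

definition up_closed :: "('v \<Rightarrow>\<^sub>0 nat) set \<Rightarrow> bool" where
  "up_closed M \<longleftrightarrow> (\<forall>m\<in>M. \<forall>n. n + m \<in> M)"

text \<open>No closure of \<open>M\<close> is built in: for \<open>up_closed M\<close> this is an
  ideal, and for \<open>M\<close> the monomials of one degree it is a graded piece, so both share
  the lemmas on sums and signs.\<close>

definition monomial_ideal :: "('v \<Rightarrow>\<^sub>0 nat) set \<Rightarrow> ('v, 'k::comm_ring_1) mpoly set" where
  "monomial_ideal M = {p. Poly_Mapping.keys p \<subseteq> M}"

lemma monomial_ideal_0: "0 \<in> monomial_ideal M"
  by (simp add: monomial_ideal_def)

lemma monomial_ideal_add: "p \<in> monomial_ideal M \<Longrightarrow> q \<in> monomial_ideal M \<Longrightarrow> p + q \<in> monomial_ideal M"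
  unfolding monomial_ideal_def using keys_add[of p q] by blast

lemma monomial_ideal_diff: "p \<in> monomial_ideal M \<Longrightarrow> q \<in> monomial_ideal M \<Longrightarrow> p - q \<in> monomial_ideal M"
  using monomial_ideal_add[of p M "- q"] by (simp add: monomial_ideal_def keys_uminus)

lemma monomial_ideal_mult:
  assumes "up_closed M" "q \<in> monomial_ideal M"
  shows "p * q \<in> monomial_ideal M"
  using assms keys_mult[of p q] by (fastforce simp: monomial_ideal_def up_closed_def)

lemma monomial_ideal_sum:
  "(\<And>i. i \<in> A \<Longrightarrow> f i \<in> monomial_ideal M) \<Longrightarrow> sum f A \<in> monomial_ideal M"
  by (induction A rule: infinite_finite_induct) (auto intro: monomial_ideal_0 monomial_ideal_add)

lemma monomial_ideal_sign: "(-1) ^ n * p \<in> monomial_ideal M \<longleftrightarrow> p \<in> monomial_ideal M"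
  by (simp add: monomial_ideal_def keys_sign_mult)

lemma homogeneous_iff: "homogeneous d p \<longleftrightarrow> p \<in> monomial_ideal {m. int (monomial_degree m) = d}"
  by (auto simp: homogeneous_def monomial_ideal_def)

lemma monomial_degree_add: "monomial_degree (m + n) = monomial_degree m + monomial_degree n"
  by (simp add: monomial_degree_def lookup_add sum.distrib)

lemma monomial_degree_vm [simp]: "monomial_degree (Poly_Mapping.single x n) = n"
  by (simp add: monomial_degree_def lookup_single when_def)

lemma monomial_degree_0_iff: "monomial_degree m = 0 \<longleftrightarrow> m = 0"
  by (auto simp: monomial_degree_def poly_mapping_eq_iff fun_eq_iff)

lemma homogeneous_add: "homogeneous d p \<Longrightarrow> homogeneous d q \<Longrightarrow> homogeneous d (p + q)"
  by (simp add: homogeneous_iff monomial_ideal_add)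

lemma homogeneous_diff: "homogeneous d p \<Longrightarrow> homogeneous d q \<Longrightarrow> homogeneous d (p - q)"
  by (simp add: homogeneous_iff monomial_ideal_diff)

lemma homogeneous_sum: "(\<And>i. i \<in> A \<Longrightarrow> homogeneous d (f i)) \<Longrightarrow> homogeneous d (sum f A)"
  by (simp add: homogeneous_iff monomial_ideal_sum)

lemma homogeneous_mult: "homogeneous a p \<Longrightarrow> homogeneous b q \<Longrightarrow> homogeneous (a + b) (p * q)"
  unfolding homogeneous_def using keys_mult[of p q] by (fastforce simp: monomial_degree_add)

lemma homogeneous_sign: "homogeneous d ((-1) ^ n * p) \<longleftrightarrow> homogeneous d p"
  by (simp add: homogeneous_iff monomial_ideal_sign)

lemma homogeneous_Var_mult: "homogeneous d p \<Longrightarrow> homogeneous (d + 1) (Var x * p)"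
  by (auto simp: homogeneous_def keys_Var_mult monomial_degree_add)

text \<open>The corresponding ideal consists of the polynomials without constant term; minimality of
  a resolution enters in this form.\<close>

lemma up_closed_nonconstant: "up_closed (- {0 :: 'v \<Rightarrow>\<^sub>0 nat})"
  by (auto simp: up_closed_def poly_mapping_eq_iff fun_eq_iff lookup_add) blast

lemma nonconstant_mult:
  assumes "Poly_Mapping.lookup q 0 = 0"
  shows "Poly_Mapping.lookup (p * q :: ('v, 'k::comm_ring_1) mpoly) 0 = 0"
proof -
  have "q \<in> monomial_ideal (- {0})"
    using assms by (auto simp: monomial_ideal_def)
  then have "p * q \<in> monomial_ideal (- {0})"
    by (rule monomial_ideal_mult[OF up_closed_nonconstant])
  then show ?thesis
    by (auto simp: monomial_ideal_def in_keys_iff)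
qed

subsection \<open>The Koszul complex\<close>

text \<open>An arbitrary total order on the variables, used for the Koszul signs and for choosing
  least variables.\<close>

definition vindex :: "'v::finite \<Rightarrow> nat" where
  "vindex = (SOME f. inj f)"

lemma inj_vindex: "inj (vindex :: 'v::finite \<Rightarrow> nat)"
proof -
  have "\<exists>f :: 'v \<Rightarrow> nat. inj f"
    using finite_imp_inj_to_nat_seg[of "UNIV :: 'v set"] by auto
  then show ?thesis
    unfolding vindex_def by (rule someI_ex)
qed

text \<open>The sign that sorts the exterior product of the basis element of \<open>x\<close> with
  that of \<open>\<sigma>\<close>.\<close>

definition ksign :: "'v::finite \<Rightarrow> 'v set \<Rightarrow> 'a::comm_ring_1" where
  "ksign x \<sigma> = (-1) ^ card {y \<in> \<sigma>. vindex y < vindex x}"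

lemma ksign_insert:
  assumes "y \<notin> \<sigma>"
  shows "ksign x (insert y \<sigma>) = (if vindex y < vindex x then - ksign x \<sigma> else ksign x \<sigma>)"
proof (cases "vindex y < vindex x")
  case True
  then have "{z \<in> insert y \<sigma>. vindex z < vindex x} = insert y {z \<in> \<sigma>. vindex z < vindex x}"
    by auto
  then show ?thesis
    using True assms by (simp add: ksign_def)
next
  case False
  then have "{z \<in> insert y \<sigma>. vindex z < vindex x} = {z \<in> \<sigma>. vindex z < vindex x}"
    by auto
  then show ?thesis
    using False by (simp add: ksign_def)
qed

text \<open>Of \<open>x\<close> and \<open>y\<close> only the smaller one precedes the other, so
  exactly one of the two insertions flips a sign.\<close>

lemma ksign_swap:
  assumes "x \<noteq> y" "x \<notin> \<sigma>" "y \<notin> \<sigma>"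
  shows "ksign x \<sigma> * ksign y (insert x \<sigma>) = - (ksign y \<sigma> * ksign x (insert y \<sigma>))"
proof -
  have "vindex x \<noteq> vindex y"
    using inj_vindex assms(1) by (auto dest: injD)
  then show ?thesis
    using assms by (auto simp: ksign_insert)
qed

lemma ksign_min: "(\<And>y. y \<in> \<sigma> \<Longrightarrow> vindex x \<le> vindex y) \<Longrightarrow> ksign x \<sigma> = 1"
proof -
  assume "\<And>y. y \<in> \<sigma> \<Longrightarrow> vindex x \<le> vindex y"
  then have *: "{y \<in> \<sigma>. vindex y < vindex x} = {}"
    by force
  show ?thesis
    unfolding ksign_def * by simp
qed

lemma ksign_mult_simps:
  "Poly_Mapping.lookup (ksign x \<sigma> * p) m = ksign x \<sigma> * Poly_Mapping.lookup p m"
  "ksign x \<sigma> * p \<in> monomial_ideal M \<longleftrightarrow> p \<in> monomial_ideal M"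
  by (simp_all add: ksign_def lookup_sign_mult monomial_ideal_sign)

text \<open>The element \<open>\<Sum>\<sigma>. z \<sigma> e\<^sub>\<sigma>\<close> of the Koszul complex of the variables is encoded by the function
  \<open>z\<close>; elements of mixed homological degree are allowed.\<close>

definition kbd :: "('v::finite set \<Rightarrow> ('v, 'k::comm_ring_1) mpoly) \<Rightarrow> 'v set \<Rightarrow> ('v, 'k) mpoly" where
  "kbd z \<sigma> = (\<Sum>x\<in>-\<sigma>. ksign x \<sigma> * (Var x * z (insert x \<sigma>)))"

lemma kbd_add: "kbd (\<lambda>\<sigma>. f \<sigma> + g \<sigma>) \<sigma> = kbd f \<sigma> + kbd g \<sigma>"
  by (simp add: kbd_def algebra_simps sum.distrib)

lemma kbd_diff: "kbd (\<lambda>\<sigma>. f \<sigma> - g \<sigma>) \<sigma> = kbd f \<sigma> - kbd g \<sigma>"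
  by (simp add: kbd_def algebra_simps sum_subtractf)

lemma kbd_mult: "kbd (\<lambda>\<sigma>. c * f \<sigma>) \<sigma> = c * kbd f \<sigma>"
  by (simp add: kbd_def sum_distrib_left algebra_simps)

lemma kbd_0: "kbd (\<lambda>\<sigma>. 0) \<sigma> = 0"
  by (simp add: kbd_def)

lemma kbd_sum: "kbd (\<lambda>\<sigma>. \<Sum>t\<in>A. f t \<sigma>) \<sigma> = (\<Sum>t\<in>A. kbd (f t) \<sigma>)"
  by (induction A rule: infinite_finite_induct) (simp_all add: kbd_0 kbd_add)

text \<open>Two variables outside \<open>\<sigma>\<close> can be inserted in either order, and the
  two resulting terms cancel by \<open>ksign_swap\<close>.\<close>

lemma kbd_kbd:
  fixes z :: "'v::finite set \<Rightarrow> ('v, 'k::comm_ring_1) mpoly"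
  shows "kbd (kbd z) \<sigma> = 0"
proof -
  define f where "f x y = ksign x \<sigma> * ksign y (insert x \<sigma>) * (Var x * Var y * z (insert x (insert y \<sigma>)))" for x y
  have *: "kbd (kbd z) \<sigma> = (\<Sum>(x, y) \<in> (SIGMA x:-\<sigma>. -insert x \<sigma>). f x y)"
  proof -
    have "kbd (kbd z) \<sigma> = (\<Sum>x\<in>-\<sigma>. \<Sum>y\<in>-insert x \<sigma>. f x y)"
      unfolding kbd_def f_def
      by (intro sum.cong refl) (simp only: sum_distrib_left insert_commute mult.assoc mult.left_commute)
    then show ?thesis
      by (simp add: sum.Sigma)
  qed
  define P where "P = {(x, y). x \<notin> \<sigma> \<and> y \<notin> \<sigma> \<and> vindex x < vindex y}"
  define Q where "Q = {(x, y). x \<notin> \<sigma> \<and> y \<notin> \<sigma> \<and> vindex y < vindex x}"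
  have PQ: "(SIGMA x:-\<sigma>. -insert x \<sigma>) = P \<union> Q" "P \<inter> Q = {}"
  proof -
    have "x \<noteq> y \<longleftrightarrow> vindex x < vindex y \<or> vindex y < vindex x" for x y :: 'v
      using injD[OF inj_vindex] by (metis linorder_neqE_nat nat_neq_iff)
    then show "(SIGMA x:-\<sigma>. -insert x \<sigma>) = P \<union> Q"
      unfolding P_def Q_def by auto
    show "P \<inter> Q = {}"
      unfolding P_def Q_def by auto
  qed
  have "(\<Sum>(x, y)\<in>Q. f x y) = (\<Sum>(x, y)\<in>P. f y x)"
    by (rule sum.reindex_bij_witness[of _ prod.swap prod.swap]) (auto simp: P_def Q_def)
  also have "\<dots> = - (\<Sum>(x, y)\<in>P. f x y)"
  proof -
    have "f y x = - f x y" if "(x, y) \<in> P" for x y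
    proof -
      have "x \<noteq> y" "x \<notin> \<sigma>" "y \<notin> \<sigma>"
        using that by (auto simp: P_def)
      from ksign_swap[OF this, where 'b = "('v, 'k) mpoly"] show ?thesis
        unfolding f_def by (simp add: insert_commute[of y x] mult.commute[of "Var y"])
    qed
    then show ?thesis
      unfolding sum_negf[symmetric] by (intro sum.cong) auto
  qed
  finally show ?thesis
    unfolding * PQ(1) by (subst sum.union_disjoint) (auto simp: PQ(2))
qed

lemma kbd_monomial_ideal:
  "up_closed M \<Longrightarrow> (\<And>\<sigma>. z \<sigma> \<in> monomial_ideal M) \<Longrightarrow> kbd z \<sigma> \<in> monomial_ideal M"
  unfolding kbd_def by (intro monomial_ideal_sum) (simp add: ksign_mult_simps monomial_ideal_mult)

text \<open>The degrees are those of the coefficients: total degree is preserved, while one exterior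
  factor is traded for a variable.\<close>

lemma kbd_homogeneous: "(\<And>\<sigma>. homogeneous d (z \<sigma>)) \<Longrightarrow> homogeneous (d + 1) (kbd z \<sigma>)"
  unfolding kbd_def 
  by (intro homogeneous_sum) (simp add: ksign_def homogeneous_sign homogeneous_Var_mult)

lemma lookup_kbd:
  "Poly_Mapping.lookup (kbd z \<sigma>) m =
     (\<Sum>x | x \<notin> \<sigma> \<and> 0 < Poly_Mapping.lookup m x.
        ksign x \<sigma> * Poly_Mapping.lookup (z (insert x \<sigma>)) (m - vm x))"
  unfolding kbd_def lookup_sum ksign_mult_simps lookup_Var_mult
  by (rule sum.mono_neutral_cong_right) auto

lemma lookup_kbd_0 [simp]: "Poly_Mapping.lookup (kbd z \<sigma>) 0 = 0"
  by (simp add: lookup_kbd)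

text \<open>A contracting homotopy: in each multidegree, contract with the least variable occurring in it.\<close>

definition khom :: "('v::finite set \<Rightarrow> ('v, 'k::comm_ring_1) mpoly) \<Rightarrow> 'v set \<Rightarrow> ('v, 'k) mpoly" where
  "khom z \<tau> = (\<Sum>y\<in>\<tau>. Poly_Mapping.mapp
     (\<lambda>m c. if \<forall>x. x \<in> \<tau> \<or> 0 < Poly_Mapping.lookup m x \<longrightarrow> vindex y \<le> vindex x then c else 0)
     (Poly_Mapping.map_key ((+) (vm y)) (z (\<tau> - {y}))))"

lemma lookup_map_key_add:
  "Poly_Mapping.lookup (Poly_Mapping.map_key ((+) n) p) m =
     Poly_Mapping.lookup p (n + m :: 'v \<Rightarrow>\<^sub>0 nat)"
  by (simp add: map_key.rep_eq)

lemma lookup_khom_aux: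
  "Poly_Mapping.lookup (khom z \<tau>) m = (\<Sum>y\<in>\<tau>. if \<forall>x. x \<in> \<tau> \<or> 0 < Poly_Mapping.lookup m x \<longrightarrow> vindex y \<le> vindex x
     then Poly_Mapping.lookup (z (\<tau> - {y})) (vm y + m) else 0)"
  unfolding khom_def lookup_sum lookup_mapp
  by (rule sum.cong) (auto simp: lookup_map_key_add when_def in_keys_iff)

text \<open>Since \<open>vindex\<close> is injective, only the summand of the least variable
  \<open>y\<close> can survive, and there is none if \<open>y\<close> lies outside
  \<open>\<tau>\<close>.\<close>

lemma lookup_khom:
  assumes "\<forall>x. x \<in> \<tau> \<or> 0 < Poly_Mapping.lookup m x \<longrightarrow> vindex y \<le> vindex x"
    and "y \<in> \<tau> \<or> 0 < Poly_Mapping.lookup m y"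
  shows "Poly_Mapping.lookup (khom z \<tau>) m =
    (if y \<in> \<tau> then Poly_Mapping.lookup (z (\<tau> - {y})) (vm y + m) else 0)"
proof -
  have "(\<forall>x. x \<in> \<tau> \<or> 0 < Poly_Mapping.lookup m x \<longrightarrow> vindex y' \<le> vindex x) \<longleftrightarrow> y' = y" if "y' \<in> \<tau>" for y'
    using assms that inj_vindex by (metis dual_order.antisym injD)
  then have "Poly_Mapping.lookup (khom z \<tau>) m =
      (\<Sum>y'\<in>\<tau>. if y' = y then Poly_Mapping.lookup (z (\<tau> - {y})) (vm y + m) else 0)"
    unfolding lookup_khom_aux by (intro sum.cong) auto
  then show ?thesis
    by simp
qed

lemma khom_homogeneous:
  assumes "\<And>\<sigma>. homogeneous d (z \<sigma>)"
  shows "homogeneous (d - 1) (khom z \<tau>)"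
  unfolding homogeneous_def
proof
  fix m assume "m \<in> Poly_Mapping.keys (khom z \<tau>)"
  then have "Poly_Mapping.lookup (khom z \<tau>) m \<noteq> 0"
    by (simp add: in_keys_iff)
  then obtain y where "Poly_Mapping.lookup (z (\<tau> - {y})) (vm y + m) \<noteq> 0"
    unfolding lookup_khom_aux
    by (rule sum.not_neutral_contains_not_neutral) (auto split: if_splits)
  then have "int (monomial_degree (vm y + m)) = d"
    using assms[of "\<tau> - {y}"] by (simp add: homogeneous_def in_keys_iff)
  then show "int (monomial_degree m) = d - 1"
    by (simp add: monomial_degree_add)
qed

text \<open>The Koszul complex of the variables is exact in every nonzero multidegree. The condition
  \<open>const\<close> removes multidegree 0, where the constants form the only homology.\<close>

lemma kbd_khom:
  fixes z :: "'v::finite set \<Rightarrow> ('v, 'k::comm_ring_1) mpoly"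
  assumes cycle: "\<And>\<sigma>. kbd z \<sigma> = 0" and const: "Poly_Mapping.lookup (z {}) 0 = 0"
  shows "kbd (khom z) \<sigma> = z \<sigma>"
proof (rule poly_mapping_eqI)
  fix m :: "'v \<Rightarrow>\<^sub>0 nat"
  let ?l = "Poly_Mapping.lookup :: ('v, 'k) mpoly \<Rightarrow> _"
  let ?e = "Poly_Mapping.lookup :: ('v \<Rightarrow>\<^sub>0 nat) \<Rightarrow> _"
  define S where "S = {x. x \<in> \<sigma> \<or> 0 < ?e m x}"
  show "?l (kbd (khom z) \<sigma>) m = ?l (z \<sigma>) m"
  proof (cases "S = {}")
    case True
    then have "\<sigma> = {}" "m = 0"
      by (auto simp: S_def poly_mapping_eq_iff fun_eq_iff)
    then show ?thesis
      using const by simp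
  next
    case False
    then obtain y where y: "y \<in> S" "\<And>x. x \<in> S \<Longrightarrow> vindex y \<le> vindex x"
      using ex_has_least_nat[of "\<lambda>x. x \<in> S" _ vindex] by blast
    define T where "T = {x. x \<notin> \<sigma> \<and> 0 < ?e m x}"
    \<comment> \<open>Moving \<open>x\<close> from the monomial to the face does not change
      \<open>S\<close>, so \<open>y\<close> remains the least variable.\<close>
    have hom: "?l (khom z (insert x \<sigma>)) (m - vm x) =
        (if y \<in> insert x \<sigma> then ?l (z (insert x \<sigma> - {y})) (vm y + (m - vm x)) else 0)" if "x \<in> T" for x
    proof (rule lookup_khom)
      show "\<forall>x'. x' \<in> insert x \<sigma> \<or> 0 < ?e (m - vm x) x' \<longrightarrow> vindex y \<le> vindex x'"
        using y(2) that by (auto simp: S_def T_def lookup_minus)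
      show "y \<in> insert x \<sigma> \<or> 0 < ?e (m - vm x) y"
        using y(1) that by (auto simp: S_def T_def lookup_minus lookup_single when_def)
    qed
    have eq: "?l (kbd (khom z) \<sigma>) m = (\<Sum>x\<in>T. ksign x \<sigma> *
        (if y \<in> insert x \<sigma> then ?l (z (insert x \<sigma> - {y})) (vm y + (m - vm x)) else 0))"
      unfolding lookup_kbd T_def[symmetric] using hom by simp
    show ?thesis
    proof (cases "y \<in> \<sigma>")
      case True
      define \<rho> where "\<rho> = \<sigma> - {y}"
      have \<rho>: "\<sigma> = insert y \<rho>" "y \<notin> \<rho>"
        using True by (auto simp: \<rho>_def)
      have T': "{x. x \<notin> \<rho> \<and> 0 < ?e (vm y + m) x} = insert y T"
        using \<rho> by (auto simp: T_def lookup_add lookup_single when_def)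
      have "y \<notin> T"
        using True by (simp add: T_def)
      \<comment> \<open>The cycle condition with \<open>y\<close> moved from the face to the
        monomial: its \<open>y\<close>-term is the wanted coefficient, and the other terms form the
        sum in \<open>eq\<close> up to sign.\<close>
      have "0 = ?l (kbd z \<rho>) (vm y + m)"
        by (simp add: cycle)
      also have "\<dots> = ksign y \<rho> * ?l (z \<sigma>) m +
          (\<Sum>x\<in>T. ksign x \<rho> * ?l (z (insert x \<rho>)) (vm y + m - vm x))"
        unfolding lookup_kbd T' using \<open>y \<notin> T\<close> \<rho> by simp
      also have "ksign y \<rho> = (1 :: 'k)"
        by (rule ksign_min) (use y(2) \<rho> in \<open>auto simp: S_def\<close>)
      also have "(\<Sum>x\<in>T. ksign x \<rho> * ?l (z (insert x \<rho>)) (vm y + m - vm x)) =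
          (\<Sum>x\<in>T. - (ksign x \<sigma> * ?l (z (insert x \<sigma> - {y})) (vm y + (m - vm x))))"
      proof (rule sum.cong)
        fix x assume x: "x \<in> T"
        then have "x \<noteq> y" "vindex y \<le> vindex x"
          using \<open>y \<notin> T\<close> y(2) by (auto simp: T_def S_def)
        then have "vindex y < vindex x"
          using inj_vindex by (metis injD order_le_less)
        then have "ksign x \<sigma> = (- ksign x \<rho> :: 'k)"
          using \<rho> by (simp add: ksign_insert)
        moreover have "insert x \<sigma> - {y} = insert x \<rho>"
          using \<open>x \<noteq> y\<close> \<rho> by auto
        moreover have "vm y + m - vm x = vm y + (m - vm x)"
          using x by (intro poly_mapping_eqI) (auto simp: T_def lookup_add lookup_minus lookup_single when_def)
        ultimately show "ksign x \<rho> * ?l (z (insert x \<rho>)) (vm y + m - vm x) =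
            - (ksign x \<sigma> * ?l (z (insert x \<sigma> - {y})) (vm y + (m - vm x)))"
          by simp
      qed simp
      finally have "?l (z \<sigma>) m =
          (\<Sum>x\<in>T. ksign x \<sigma> * ?l (z (insert x \<sigma> - {y})) (vm y + (m - vm x)))"
        by (simp add: sum_negf)
      then show ?thesis
        unfolding eq using True by simp
    next
      case False
      then have "y \<in> T"
        using y(1) by (auto simp: S_def T_def)
      \<comment> \<open>Contraction with \<open>y\<close> is now possible only on
        \<open>insert y \<sigma>\<close>, so one summand survives, with sign 1.\<close>
      have "?l (kbd (khom z) \<sigma>) m = (\<Sum>x\<in>T. if x = y then ?l (z \<sigma>) m else 0)"
        unfolding eq
      proof (rule sum.cong)
        fix x assume "x \<in> T"
        show "ksign x \<sigma> * (if y \<in> insert x \<sigma>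
            then ?l (z (insert x \<sigma> - {y})) (vm y + (m - vm x)) else 0) = (if x = y then ?l (z \<sigma>) m else 0)"
        proof (cases "x = y")
          case True
          moreover have "ksign y \<sigma> = (1 :: 'k)"
            by (rule ksign_min) (use y(2) in \<open>auto simp: S_def\<close>)
          moreover have "vm y + (m - vm y) = m"
            using \<open>y \<in> T\<close> by (intro vm_add_diff) (simp add: T_def)
          ultimately show ?thesis
            using False by simp
        qed (use False in simp)
      qed simp
      also have "\<dots> = ?l (z \<sigma>) m"
        using \<open>y \<in> T\<close> by simp
      finally show ?thesis .
    qed
  qed
qed

section \<open>Generated ideals inside monomial ideals\<close>

lemma module_mult: "Modules.module ((*) :: 'r::comm_ring_1 \<Rightarrow> 'r \<Rightarrow> 'r)"
  by unfold_locales (simp_all add: algebra_simps)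

lemma ideal_generated_subset_monomial_ideal:
  fixes B :: "('v, 'k::comm_ring_1) mpoly set"
  assumes "up_closed M" "B \<subseteq> monomial_ideal M"
  shows "ideal_generated B \<subseteq> monomial_ideal M"
  unfolding ideal_generated_def
proof (rule Modules.module.span_minimal[OF module_mult assms(2)])
  show "Modules.module.subspace (*) (monomial_ideal M :: ('v, 'k) mpoly set)"
    unfolding Modules.module.subspace_def[OF module_mult]
    using assms(1) monomial_ideal_0 monomial_ideal_add monomial_ideal_mult by blast
qed

lemma poly_mapping_eq_sum_single:
  "p = (\<Sum>m\<in>Poly_Mapping.keys p. Poly_Mapping.single m (Poly_Mapping.lookup p m))"
  by (rule poly_mapping_eqI) (auto simp: lookup_sum lookup_single when_def in_keys_iff)

subsection \<open>Vanishing of Koszul homology\<close>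

text \<open>Koszul homology of \<open>R/I\<close> vanishes in all bidegrees with internal degree greater than \<open>r\<close>. The
  internal degree of an element of \<open>K\<^sub>i\<close> of total degree \<open>j\<close> is \<open>j - i\<close>, which is why no
  homological degree has to be mentioned.\<close>

definition koszul_reg_le :: "('v::finite, 'k::comm_ring_1) mpoly set \<Rightarrow> int \<Rightarrow> bool" where
  "koszul_reg_le I r \<longleftrightarrow> (\<forall>d z. r < d \<and> (\<forall>\<sigma>. homogeneous d (z \<sigma>)) \<and> (\<forall>\<sigma>. kbd z \<sigma> \<in> I) \<longrightarrow>
     (\<exists>w. (\<forall>\<sigma>. homogeneous (d - 1) (w \<sigma>)) \<and> (\<forall>\<sigma>. z \<sigma> - kbd w \<sigma> \<in> I)))"

lemma koszul_reg_leI: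
  assumes "\<And>d z. r < d \<Longrightarrow> (\<And>\<sigma>. homogeneous d (z \<sigma>)) \<Longrightarrow> (\<And>\<sigma>. kbd z \<sigma> \<in> I) \<Longrightarrow>
     \<exists>w. (\<forall>\<sigma>. homogeneous (d - 1) (w \<sigma>)) \<and> (\<forall>\<sigma>. z \<sigma> - kbd w \<sigma> \<in> I)"
  shows "koszul_reg_le I r"
  using assms unfolding koszul_reg_le_def by blast

lemma koszul_reg_leE:
  assumes "koszul_reg_le I r" "r < d" "\<And>\<sigma>. homogeneous d (z \<sigma>)" "\<And>\<sigma>. kbd z \<sigma> \<in> I"
  obtains w where "\<And>\<sigma>. homogeneous (d - 1) (w \<sigma>)" "\<And>\<sigma>. z \<sigma> - kbd w \<sigma> \<in> I"
  using assms unfolding koszul_reg_le_def by metis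

lemma koszul_reg_le_mono: "koszul_reg_le I r \<Longrightarrow> r \<le> s \<Longrightarrow> koszul_reg_le I s"
  unfolding koszul_reg_le_def by (meson order_le_less_trans)

text \<open>\<open>monomial_ideal {}\<close> is the zero ideal. A cycle of positive internal degree
  has no constant term, so \<open>khom\<close> exhibits it as a boundary.\<close>

lemma koszul_reg_le_zero: "koszul_reg_le (monomial_ideal {}) 0"
proof (rule koszul_reg_leI)
  fix d :: int and z :: "'a set \<Rightarrow> ('a, 'b) mpoly"
  assume d: "0 < d" and z: "\<And>\<sigma>. homogeneous d (z \<sigma>)" "\<And>\<sigma>. kbd z \<sigma> \<in> monomial_ideal {}"
  have "kbd z \<sigma> = 0" for \<sigma>
    using z(2)[of \<sigma>] by (simp add: monomial_ideal_def)
  moreover have "Poly_Mapping.lookup (z {}) 0 = 0"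
  proof (rule ccontr)
    assume "Poly_Mapping.lookup (z {}) 0 \<noteq> 0"
    then have "int (monomial_degree (0 :: 'a \<Rightarrow>\<^sub>0 nat)) = d"
      using z(1)[of "{}"] by (simp add: homogeneous_def in_keys_iff)
    then show False
      using d by (simp add: monomial_degree_def)
  qed
  ultimately have "z \<sigma> - kbd (khom z) \<sigma> = 0" for \<sigma>
    by (simp add: kbd_khom)
  then show "\<exists>w. (\<forall>\<sigma>. homogeneous (d - 1) (w \<sigma>)) \<and> (\<forall>\<sigma>. z \<sigma> - kbd w \<sigma> \<in> monomial_ideal {})"
    using khom_homogeneous[of d z] z(1) by (metis monomial_ideal_0)
qed

abbreviation colon_var :: "('v \<Rightarrow>\<^sub>0 nat) set \<Rightarrow> 'v \<Rightarrow> ('v \<Rightarrow>\<^sub>0 nat) set" where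
  "colon_var M x \<equiv> {m. vm x + m \<in> M}"

abbreviation plus_var :: "('v \<Rightarrow>\<^sub>0 nat) set \<Rightarrow> 'v \<Rightarrow> ('v \<Rightarrow>\<^sub>0 nat) set" where
  "plus_var M x \<equiv> M \<union> {m. 0 < Poly_Mapping.lookup m x}"

lemma Var_mult_in_monomial_ideal:
  "Var x * p \<in> monomial_ideal M \<longleftrightarrow> p \<in> monomial_ideal (colon_var M x)"
  by (auto simp: monomial_ideal_def keys_Var_mult)

text \<open>Divide by \<open>x\<close> the terms that it divides; the monomials of the remaining
  terms must lie in \<open>M\<close>.\<close>

lemma plus_var_decompose:
  assumes "f \<in> monomial_ideal (plus_var M x)" "homogeneous d f"
  obtains u where "homogeneous (d - 1) u" "f - Var x * u \<in> monomial_ideal M"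
proof
  define u where "u = Poly_Mapping.map_key ((+) (vm x)) f"
  have u: "Poly_Mapping.lookup u m = Poly_Mapping.lookup f (vm x + m)" for m
    by (simp add: u_def lookup_map_key_add)
  have "int (monomial_degree m) = d - 1" if "m \<in> Poly_Mapping.keys u" for m
  proof -
    have "vm x + m \<in> Poly_Mapping.keys f"
      using that by (simp add: in_keys_iff u)
    then have "int (monomial_degree (vm x + m)) = d"
      using assms(2) by (auto simp: homogeneous_def)
    then show ?thesis
      by (simp add: monomial_degree_add)
  qed
  then show "homogeneous (d - 1) u"
    by (simp add: homogeneous_def)
  have "m \<in> M" if "m \<in> Poly_Mapping.keys (f - Var x * u)" for m
  proof -
    have "Poly_Mapping.lookup (f - Var x * u) m =
        (if 0 < Poly_Mapping.lookup m x then 0 else Poly_Mapping.lookup f m)"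
      using vm_add_diff[of m x] by (simp add: lookup_minus lookup_Var_mult u)
    then have "m \<in> Poly_Mapping.keys f" "\<not> 0 < Poly_Mapping.lookup m x"
      using that by (auto simp: in_keys_iff split: if_splits)
    then show ?thesis
      using assms(1) by (auto simp: monomial_ideal_def)
  qed
  then show "f - Var x * u \<in> monomial_ideal M"
    by (auto simp: monomial_ideal_def)
qed

lemma monomial_ideal_mono: "p \<in> monomial_ideal M \<Longrightarrow> M \<subseteq> N \<Longrightarrow> p \<in> monomial_ideal N"
  by (auto simp: monomial_ideal_def)

text \<open>The long exact sequence of \<open>0 \<rightarrow> R/(I:x)(-1) \<rightarrow> R/I \<rightarrow> R/(I,x) \<rightarrow> 0\<close> at its middle term.\<close>

lemma koszul_reg_le_colon_plus:
  assumes M: "up_closed M"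
    and colon: "koszul_reg_le (monomial_ideal (colon_var M x) :: ('v::finite, 'k::comm_ring_1) mpoly set) (r - 1)"
    and plus: "koszul_reg_le (monomial_ideal (plus_var M x) :: ('v, 'k) mpoly set) r"
  shows "koszul_reg_le (monomial_ideal M :: ('v, 'k) mpoly set) r"
proof (rule koszul_reg_leI)
  fix d :: int and z :: "'v set \<Rightarrow> ('v, 'k) mpoly"
  assume d: "r < d" and z: "\<And>\<sigma>. homogeneous d (z \<sigma>)" "\<And>\<sigma>. kbd z \<sigma> \<in> monomial_ideal M"
  obtain w where w: "\<And>\<sigma>. homogeneous (d - 1) (w \<sigma>)"
      "\<And>\<sigma>. z \<sigma> - kbd w \<sigma> \<in> monomial_ideal (plus_var M x)"
  proof (rule koszul_reg_leE[OF plus d, where z = z])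
    show "kbd z \<sigma> \<in> monomial_ideal (plus_var M x)" for \<sigma>
      by (rule monomial_ideal_mono[OF z(2)]) simp
  qed (use z(1) in blast)+
  \<comment> \<open>Modulo the ideal of \<open>M\<close>, the error left by \<open>w\<close> is a
    multiple of \<open>x\<close>; its quotient \<open>u\<close> is treated as a new cycle.\<close>
  have "\<exists>u. homogeneous (d - 1) u \<and> z \<sigma> - kbd w \<sigma> - Var x * u \<in> monomial_ideal M" for \<sigma>
  proof (rule plus_var_decompose[OF w(2)])
    show "homogeneous d (z \<sigma> - kbd w \<sigma>)" for \<sigma>
      using kbd_homogeneous[of "d - 1" w \<sigma>] w(1) z(1) by (simp add: homogeneous_diff)
  qed blast
  then obtain u where u: "\<And>\<sigma>. homogeneous (d - 1) (u \<sigma>)"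
      "\<And>\<sigma>. z \<sigma> - kbd w \<sigma> - Var x * u \<sigma> \<in> monomial_ideal M"
    by metis
  \<comment> \<open>Applying \<open>kbd\<close> to the relation that defines \<open>u\<close> leaves
    \<open>Var x * kbd u \<sigma>\<close> in the ideal of \<open>M\<close>.\<close>
  have "kbd u \<sigma> \<in> monomial_ideal (colon_var M x)" for \<sigma>
  proof -
    have "kbd (\<lambda>\<sigma>. z \<sigma> - kbd w \<sigma> - Var x * u \<sigma>) \<sigma> \<in> monomial_ideal M"
      by (rule kbd_monomial_ideal[OF M u(2)])
    then have "kbd z \<sigma> - Var x * kbd u \<sigma> \<in> monomial_ideal M"
      by (simp add: kbd_diff kbd_mult kbd_kbd)
    from monomial_ideal_diff[OF z(2)[of \<sigma>] this] show ?thesis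
      by (simp add: Var_mult_in_monomial_ideal)
  qed
  then obtain v where v: "\<And>\<sigma>. homogeneous (d - 1 - 1) (v \<sigma>)"
      "\<And>\<sigma>. u \<sigma> - kbd v \<sigma> \<in> monomial_ideal (colon_var M x)"
    using koszul_reg_leE[OF colon, where z = u and d = "d - 1"] u(1) d by auto
  have "z \<sigma> - kbd (\<lambda>\<sigma>. w \<sigma> + Var x * v \<sigma>) \<sigma> \<in> monomial_ideal M" for \<sigma>
  proof -
    have "Var x * (u \<sigma> - kbd v \<sigma>) \<in> monomial_ideal M"
      using v(2) by (simp add: Var_mult_in_monomial_ideal)
    from monomial_ideal_add[OF u(2)[of \<sigma>] this] show ?thesis
      by (simp add: kbd_add kbd_mult algebra_simps)
  qed
  moreover have "homogeneous (d - 1) (w \<sigma> + Var x * v \<sigma>)" for \<sigma>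
    using w(1) homogeneous_Var_mult[OF v(1)] by (auto intro: homogeneous_add)
  ultimately show "\<exists>w. (\<forall>\<sigma>. homogeneous (d - 1) (w \<sigma>)) \<and> (\<forall>\<sigma>. z \<sigma> - kbd w \<sigma> \<in> monomial_ideal M)"
    by (intro exI[of _ "\<lambda>\<sigma>. w \<sigma> + Var x * v \<sigma>"]) simp
qed

text \<open>The same sequence at its right-hand term, for a nonzerodivisor \<open>x\<close> on \<open>R/I\<close>.\<close>

lemma koszul_reg_le_plus_var:
  assumes M: "up_closed M" "colon_var M x \<subseteq> M"
    and reg: "koszul_reg_le (monomial_ideal M :: ('v::finite, 'k::comm_ring_1) mpoly set) r"
  shows "koszul_reg_le (monomial_ideal (plus_var M x) :: ('v, 'k) mpoly set) r"
proof (rule koszul_reg_leI)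
  fix d :: int and z :: "'v set \<Rightarrow> ('v, 'k) mpoly"
  assume d: "r < d" and z: "\<And>\<sigma>. homogeneous d (z \<sigma>)" "\<And>\<sigma>. kbd z \<sigma> \<in> monomial_ideal (plus_var M x)"
  \<comment> \<open>\<open>u\<close> represents the image of \<open>z\<close> under the connecting
    homomorphism.\<close>
  have "\<exists>u. homogeneous d u \<and> kbd z \<sigma> - Var x * u \<in> monomial_ideal M" for \<sigma>
    using plus_var_decompose[OF z(2) kbd_homogeneous[OF z(1)]] by (metis add_diff_cancel_right')
  then obtain u where u: "\<And>\<sigma>. homogeneous d (u \<sigma>)"
      "\<And>\<sigma>. kbd z \<sigma> - Var x * u \<sigma> \<in> monomial_ideal M"
    by metis
  have "kbd u \<sigma> \<in> monomial_ideal M" for \<sigma>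
  proof -
    have "kbd (\<lambda>\<sigma>. kbd z \<sigma> - Var x * u \<sigma>) \<sigma> \<in> monomial_ideal M"
      by (rule kbd_monomial_ideal[OF M(1) u(2)])
    then have "Var x * kbd u \<sigma> \<in> monomial_ideal M"
      by (simp add: kbd_diff kbd_mult kbd_kbd monomial_ideal_def keys_uminus)
    then show ?thesis
      using M(2) by (auto simp: Var_mult_in_monomial_ideal intro: monomial_ideal_mono)
  qed
  then obtain v where v: "\<And>\<sigma>. homogeneous (d - 1) (v \<sigma>)" "\<And>\<sigma>. u \<sigma> - kbd v \<sigma> \<in> monomial_ideal M"
    using koszul_reg_leE[OF reg d, where z = u] u(1) by blast
  \<comment> \<open>Correcting by a multiple of \<open>x\<close> keeps the class modulo
    \<open>plus_var M x\<close> and turns \<open>z\<close> into a cycle modulo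
    \<open>M\<close>.\<close>
  define y where "y = (\<lambda>\<sigma>. z \<sigma> - Var x * v \<sigma>)"
  have "homogeneous d (y \<sigma>)" for \<sigma>
    unfolding y_def using z(1) homogeneous_Var_mult[OF v(1)] by (auto intro: homogeneous_diff)
  moreover have "kbd y \<sigma> \<in> monomial_ideal M" for \<sigma>
  proof -
    have "kbd y \<sigma> = (kbd z \<sigma> - Var x * u \<sigma>) + Var x * (u \<sigma> - kbd v \<sigma>)"
      by (simp add: y_def kbd_diff kbd_mult algebra_simps)
    then show ?thesis
      using u(2) v(2) by (simp add: monomial_ideal_add monomial_ideal_mult[OF M(1)])
  qed
  ultimately obtain w where w: "\<And>\<sigma>. homogeneous (d - 1) (w \<sigma>)" "\<And>\<sigma>. y \<sigma> - kbd w \<sigma> \<in> monomial_ideal M"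
    using koszul_reg_leE[OF reg d, where z = y] by blast
  have "z \<sigma> - kbd w \<sigma> \<in> monomial_ideal (plus_var M x)" for \<sigma>
  proof -
    have "Var x * v \<sigma> \<in> monomial_ideal (plus_var M x)"
      by (auto simp: monomial_ideal_def keys_Var_mult lookup_add)
    from monomial_ideal_add[OF monomial_ideal_mono[OF w(2)[of \<sigma>]] this] show ?thesis
      by (simp add: y_def algebra_simps)
  qed
  then show "\<exists>w. (\<forall>\<sigma>. homogeneous (d - 1) (w \<sigma>)) \<and> (\<forall>\<sigma>. z \<sigma> - kbd w \<sigma> \<in> monomial_ideal (plus_var M x))"
    using w(1) by blast
qed

subsection \<open>Star packings\<close>

text \<open>Since the edges left over by a maximal packing are isolated edges of the graph, \<open>\<zeta>(G)\<close> is the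
  maximal size of an independent set of the following vertices: the vertices of degree at least two
  and the ends of isolated edges.\<close>

definition central :: "'v set set \<Rightarrow> 'v \<Rightarrow> bool" where
  "central E x \<longleftrightarrow> 2 \<le> vertex_degree E x \<or> (\<exists>y. neighbors E x = {y} \<and> neighbors E y = {x})"

definition central_independent :: "'v set set \<Rightarrow> 'v set \<Rightarrow> bool" where
  "central_independent E A \<longleftrightarrow> independent_set E A \<and> (\<forall>x\<in>A. central E x)"

lemma neighbors_sym: "y \<in> neighbors E x \<longleftrightarrow> x \<in> neighbors E y"
  by (simp add: neighbors_def insert_commute)

lemma neighbors_irrefl: "simple_graph E \<Longrightarrow> x \<notin> neighbors E x"
  by (auto simp: neighbors_def simple_graph_def)

lemma independent_set_iff: "independent_set E A \<longleftrightarrow> (\<forall>x\<in>A. \<forall>y\<in>A. y \<notin> neighbors E x)"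
  by (simp add: independent_set_def neighbors_def)

lemma central_neighbors_nonempty: "central E x \<Longrightarrow> neighbors E x \<noteq> {}"
  by (auto simp: central_def vertex_degree_def)

lemma vertex_degree_less_2:
  fixes E :: "'v::finite set set"
  assumes "y \<in> neighbors E x" "\<not> 2 \<le> vertex_degree E x"
  shows "neighbors E x = {y}"
proof -
  have "card (neighbors E x) \<noteq> 0"
    using assms(1) by auto
  then have "card (neighbors E x) = 1"
    using assms(2) unfolding vertex_degree_def by linarith
  then show ?thesis
    using assms(1) by (auto simp: card_1_singleton_iff)
qed

text \<open>If both ends of an edge have degree less than two, the edge is isolated; in every case
  one end is central.\<close>

lemma exists_central:
  fixes E :: "'v::finite set set"
  assumes "simple_graph E" "E \<noteq> {}"
  shows "\<exists>x. central E x"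
proof -
  obtain e where "e \<in> E"
    using assms(2) by blast
  then obtain x y where "{x, y} \<in> E"
    using assms(1) unfolding simple_graph_def card_2_iff by metis
  then have "y \<in> neighbors E x" "x \<in> neighbors E y"
    by (simp_all add: neighbors_def insert_commute)
  then show ?thesis
    using vertex_degree_less_2 unfolding central_def by metis
qed

text \<open>Deleting vertices creates new isolated edges \<open>{a, b}\<close> only if \<open>a\<close> or \<open>b\<close> had degree at least two.\<close>

lemma central_independent_lift:
  fixes E :: "'v::finite set set"
  assumes A: "central_independent {e \<in> E. e \<inter> Z = {}} A"
  obtains B where "central_independent E B" "card B = card A" "B \<inter> Z = {}"
proof -
  define E' where "E' = {e \<in> E. e \<inter> Z = {}}"
  have nb: "y \<in> neighbors E' x \<longleftrightarrow> y \<in> neighbors E x \<and> x \<notin> Z \<and> y \<notin> Z" for x y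
    by (auto simp: E'_def neighbors_def)
  have indep: "y \<notin> neighbors E' x" if "x \<in> A" "y \<in> A" for x y
    using A that by (simp add: central_independent_def independent_set_iff E'_def)
  have central: "central E' x" if "x \<in> A" for x
    using A that by (simp add: central_independent_def E'_def)
  \<comment> \<open>Such an \<open>x\<close> is an end of an edge isolated in \<open>E'\<close>. If
    the other end had degree one in \<open>E\<close>, the edge would be isolated in \<open>E\<close>
    already and \<open>x\<close> central.\<close>
  have swap: "\<exists>y. neighbors E' x = {y} \<and> neighbors E' y = {x} \<and> central E y" if x: "x \<in> A" "\<not> central E x" for x
  proof -
    have deg: "\<not> 2 \<le> vertex_degree E x"
      using x(2) by (auto simp: central_def)
    have "vertex_degree E' x \<le> vertex_degree E x"
      unfolding vertex_degree_def by (rule card_mono) (auto simp: nb)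
    then obtain y where y: "neighbors E' x = {y}" "neighbors E' y = {x}"
      using central[OF x(1)] deg by (auto simp: central_def)
    then have "y \<in> neighbors E x" "x \<in> neighbors E y"
      using nb by blast+
    then have "2 \<le> vertex_degree E y"
      using vertex_degree_less_2[OF \<open>y \<in> neighbors E x\<close> deg] vertex_degree_less_2[of x E y] x(2)
      by (auto simp: central_def)
    then show ?thesis
      using y by (auto simp: central_def)
  qed
  \<comment> \<open>Vertices that are no longer central are exchanged for the other end of their
    edge.\<close>
  define f where "f x = (if central E x then x else (SOME y. neighbors E' x = {y} \<and> neighbors E' y = {x} \<and> central E y))" for x
  have f1: "f x = x" if "central E x" for x
    using that by (simp add: f_def)
  have f2: "neighbors E' x = {f x}" "neighbors E' (f x) = {x}" "central E (f x)" if "x \<in> A" "\<not> central E x" for x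
    using someI_ex[OF swap[OF that]] that by (simp_all add: f_def)
  have f_central: "central E (f x)" if "x \<in> A" for x
    using f1 f2(3) that by metis
  have fZ: "f x \<notin> Z" if "x \<in> A" for x
  proof (cases "central E x")
    case True
    then show ?thesis
      using central_neighbors_nonempty[OF central[OF that]] nb f1 by (metis ex_in_conv)
  next
    case False
    then show ?thesis
      using f2(1)[OF that False] nb by blast
  qed
  have f_cases: "f x = x \<or> neighbors E' x = {f x} \<and> neighbors E' (f x) = {x}" if "x \<in> A" for x
    using f1 f2 that by metis
  have "inj_on f A"
  proof (rule inj_onI)
    \<comment> \<open>Distinct \<open>x\<close> and \<open>y\<close> would be adjacent in
      \<open>E'\<close>, or each would be the only neighbour of the common image.\<close>
    fix x y assume "x \<in> A" "y \<in> A" "f x = f y"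
    then show "x = y"
      using f_cases[of x] f_cases[of y] indep[of x y] indep[of y x] by auto
  qed
  \<comment> \<open>The images avoid \<open>Z\<close>, so an edge of \<open>E\<close> between them
    survives in \<open>E'\<close>, where it forces an edge inside \<open>A\<close>.\<close>
  moreover have "f y \<notin> neighbors E (f x)" if "x \<in> A" "y \<in> A" for x y
  proof
    assume "f y \<in> neighbors E (f x)"
    then have "f y \<in> neighbors E' (f x)" "f x \<in> neighbors E' (f y)"
      using nb fZ that neighbors_sym by metis+
    then show False
      using f_cases[OF that(1)] f_cases[OF that(2)] indep[OF that] indep[OF that(2,1)]
        indep[OF that(1,1)] indep[OF that(2,2)] by auto
  qed
  ultimately show ?thesis
    using that[of "f ` A"] f_central fZ
    by (auto simp: central_independent_def independent_set_iff card_image)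
qed

lemma independent_set_insert:
  assumes "simple_graph E" "independent_set E A" "A \<inter> neighbors E x = {}"
  shows "independent_set E (insert x A)"
proof -
  have "x \<notin> neighbors E y" if "y \<in> A" for y
    using assms(3) that neighbors_sym[of x E y] by blast
  then show ?thesis
    using assms neighbors_irrefl[of E x] unfolding independent_set_iff by blast
qed

text \<open>The vertices of \<open>A\<close> of degree at least two extend to a maximal packing
  \<open>S\<close>. Each other vertex of \<open>A\<close> contributes its own isolated edge, which
  is among the edges left over by \<open>S\<close>.\<close>

lemma card_central_independent_le_zeta:
  fixes E :: "'v::finite set set"
  assumes A: "central_independent E A"
  shows "card A \<le> zeta E"
proof -
  define S0 where "S0 = {x \<in> A. 2 \<le> vertex_degree E x}"
  have "star_packing E S0"
    using A by (auto simp: S0_def star_packing_def central_independent_def independent_set_def)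
  moreover have "finite {S. star_packing E S}"
    by simp
  ultimately obtain S where S: "star_packing E S" "S0 \<subseteq> S"
      "\<And>T. star_packing E T \<Longrightarrow> S \<subseteq> T \<Longrightarrow> T = S"
    using finite_has_maximal2[of "{S. star_packing E S}" S0] by (metis mem_Collect_eq)
  then have max: "maximal_star_packing E S"
    by (auto simp: maximal_star_packing_def)
  define L where "L = A - S0"
  have L: "\<exists>y. neighbors E x = {y} \<and> neighbors E y = {x}" if "x \<in> L" for x
    using A that by (auto simp: L_def S0_def central_independent_def central_def)
  \<comment> \<open>For \<open>x\<close> in \<open>L\<close> this is the isolated edge through
    \<open>x\<close>.\<close>
  define g where "g x = insert x (neighbors E x)" for x
  have "inj_on g L"
  proof (rule inj_onI)
    fix x y assume xy: "x \<in> L" "y \<in> L" "g x = g y"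
    then have "y \<notin> neighbors E x"
      using A by (auto simp: L_def central_independent_def independent_set_iff)
    then show "x = y"
      using xy(3) by (auto simp: g_def)
  qed
  moreover have "g ` L \<subseteq> induced_edges E (UNIV - closed_nbhd E S)"
  proof
    fix e assume "e \<in> g ` L"
    then obtain x where "x \<in> L" "e = g x"
      by blast
    with L[of x] obtain y where x: "x \<in> L" "neighbors E x = {y}" "neighbors E y = {x}" "e = {x, y}"
      by (auto simp: g_def)
    \<comment> \<open>A centre whose closed neighbourhood meets the isolated edge would be one of
      its ends, which have degree one.\<close>
    have "z \<notin> closed_nbhd E S" if "z \<in> {x, y}" for z
    proof
      assume "z \<in> closed_nbhd E S"
      then obtain s where s: "s \<in> S" "z = s \<or> z \<in> neighbors E s"
        by (auto simp: closed_nbhd_def)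
      then have "s \<in> {x, y}"
        using that x(2,3) neighbors_sym[of z E s] by auto
      then have "vertex_degree E s = 1"
        using x by (auto simp: vertex_degree_def)
      then show False
        using S(1) s(1) by (fastforce simp: star_packing_def)
    qed
    moreover have "e \<in> E"
      using x(2,4) by (auto simp: neighbors_def)
    ultimately show "e \<in> induced_edges E (UNIV - closed_nbhd E S)"
      using x(4) by (auto simp: induced_edges_def)
  qed
  ultimately have "card L \<le> card (induced_edges E (UNIV - closed_nbhd E S))"
    by (intro card_inj_on_le) auto
  moreover have "card S0 \<le> card S"
    using S(2) by (intro card_mono) auto
  moreover have "card A = card S0 + card L"
    unfolding L_def using card_Diff_subset[of S0 A] card_mono[of A S0] by (simp add: S0_def)
  ultimately have "card A \<le> zeta_at E S"
    by (simp add: zeta_at_def)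
  also have "\<dots> \<le> zeta E"
    unfolding zeta_def using max by (intro Max_ge) auto
  finally show ?thesis .
qed

subsection \<open>Edge ideals\<close>

text \<open>The monomials of the ideal generated by the edge ideal and the variables in
  \<open>W\<close>. The extra variables make the family stable under the two operations of the
  induction.\<close>

definition graph_monomials :: "'v set set \<Rightarrow> 'v set \<Rightarrow> ('v \<Rightarrow>\<^sub>0 nat) set" where
  "graph_monomials E W = {m. (\<exists>x\<in>W. 0 < Poly_Mapping.lookup m x) \<or>
     (\<exists>e\<in>E. \<forall>x\<in>e. 0 < Poly_Mapping.lookup m x)}"

lemma up_closed_graph_monomials: "up_closed (graph_monomials E W)"
  unfolding up_closed_def
proof (intro ballI allI)
  fix m n :: "'a \<Rightarrow>\<^sub>0 nat"
  assume "m \<in> graph_monomials E W"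
  then consider (var) x where "x \<in> W" "0 < Poly_Mapping.lookup m x"
    | (edge) e where "e \<in> E" "\<forall>x\<in>e. 0 < Poly_Mapping.lookup m x"
    unfolding graph_monomials_def by blast
  then show "n + m \<in> graph_monomials E W"
  proof cases
    case edge
    then have "\<forall>x\<in>e. 0 < Poly_Mapping.lookup (n + m) x"
      by (simp add: lookup_add)
    then show ?thesis
      using edge(1) unfolding graph_monomials_def by blast
  qed (auto simp: graph_monomials_def lookup_add)
qed

text \<open>An edge monomial through \<open>x\<close> is already a multiple of
  \<open>x\<close>.\<close>

lemma plus_var_graph_monomials:
  "plus_var (graph_monomials E W) x = graph_monomials {e \<in> E. x \<notin> e} (insert x W)"
proof (intro equalityI subsetI)
  fix m assume "m \<in> plus_var (graph_monomials E W) x"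
  then show "m \<in> graph_monomials {e \<in> E. x \<notin> e} (insert x W)"
    unfolding graph_monomials_def by blast
next
  fix m assume "m \<in> graph_monomials {e \<in> E. x \<notin> e} (insert x W)"
  then show "m \<in> plus_var (graph_monomials E W) x"
    unfolding graph_monomials_def by blast
qed

lemma simple_graph_edgeE:
  assumes "simple_graph E" "e \<in> E" "x \<in> e"
  obtains y where "e = {x, y}" "x \<noteq> y" "y \<in> neighbors E x"
proof -
  obtain a b where "e = {a, b}" "a \<noteq> b"
    using assms(1,2) unfolding simple_graph_def card_2_iff by metis
  then show ?thesis
    using assms(2,3) that[of a] that[of b] by (auto simp: neighbors_def insert_commute)
qed

text \<open>The neighbours of \<open>x\<close> become generators of the colon ideal and absorb every
  edge that meets the closed neighbourhood, including the edges through \<open>x\<close>.\<close>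

lemma colon_var_graph_monomials:
  assumes "simple_graph E" "x \<notin> W"
  shows "colon_var (graph_monomials E W) x =
    graph_monomials {e \<in> E. e \<inter> closed_nbhd E {x} = {}} (W \<union> neighbors E x)" (is "?L = ?R")
proof (intro equalityI subsetI)
  fix m assume "m \<in> ?L"
  then consider (var) w where "w \<in> W" "0 < Poly_Mapping.lookup (vm x + m) w"
    | (edge) e where "e \<in> E" "\<forall>y\<in>e. 0 < Poly_Mapping.lookup (vm x + m) y"
    by (auto simp: graph_monomials_def)
  then show "m \<in> ?R"
  proof cases
    case var
    then show ?thesis
      using assms(2) by (auto simp: graph_monomials_def lookup_add lookup_single when_def split: if_splits)
  next
    case edge
    have pos: "0 < Poly_Mapping.lookup m y" if "y \<in> e" "y \<noteq> x" for y
      using edge(2) that by (auto simp: lookup_add lookup_single when_def)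
    show ?thesis
    proof (cases "\<exists>y\<in>e. y \<in> neighbors E x")
      case True
      then obtain y where y: "y \<in> e" "y \<in> neighbors E x"
        by blast
      then have "y \<noteq> x"
        using assms(1) by (auto simp: neighbors_def simple_graph_def)
      then show ?thesis
        using y pos by (auto simp: graph_monomials_def)
    next
      case False
      then have "x \<notin> e"
        using edge(1) simple_graph_edgeE[OF assms(1)] by (metis insertI1 insert_commute)
      then have "e \<inter> closed_nbhd E {x} = {}" "\<forall>y\<in>e. 0 < Poly_Mapping.lookup m y"
        using False pos by (auto simp: closed_nbhd_def)
      then show ?thesis
        using edge(1) by (auto simp: graph_monomials_def)
    qed
  qed
next
  fix m assume "m \<in> ?R"
  then consider (var) w where "w \<in> W" "0 < Poly_Mapping.lookup m w"
    | (nb) y where "{x, y} \<in> E" "0 < Poly_Mapping.lookup m y"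
    | (edge) e where "e \<in> E" "\<forall>y\<in>e. 0 < Poly_Mapping.lookup m y"
    by (auto simp: graph_monomials_def neighbors_def)
  then show "m \<in> ?L"
  proof cases
    case var
    then show ?thesis
      by (auto simp: graph_monomials_def lookup_add)
  next
    case nb
    then have "\<forall>z\<in>{x, y}. 0 < Poly_Mapping.lookup (vm x + m) z"
      by (auto simp: lookup_add)
    then show ?thesis
      using nb(1) unfolding graph_monomials_def by blast
  next
    case edge
    then have "\<forall>z\<in>e. 0 < Poly_Mapping.lookup (vm x + m) z"
      by (auto simp: lookup_add)
    then show ?thesis
      using edge(1) unfolding graph_monomials_def by blast
  qed
qed

text \<open>The variables are added one at a time, each being a nonzerodivisor modulo the previous
  ones.\<close>

lemma koszul_reg_le_variables:
  "koszul_reg_le (monomial_ideal (graph_monomials {} W) :: ('v::finite, 'k::comm_ring_1) mpoly set) 0"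
proof (induction W rule: finite_induct[OF finite])
  case 1
  show ?case
    using koszul_reg_le_zero by (simp add: graph_monomials_def)
next
  case (2 x W)
  have "colon_var (graph_monomials {} W) x \<subseteq> graph_monomials {} W"
    using 2(2) by (auto simp: graph_monomials_def lookup_add lookup_single when_def split: if_splits)
  from koszul_reg_le_plus_var[OF up_closed_graph_monomials this 2(3)] show ?case
    by (simp add: plus_var_graph_monomials)
qed

lemma edge_ideal_eq_monomial_ideal:
  assumes "simple_graph E"
  shows "edge_ideal E = (monomial_ideal (graph_monomials E {}) :: ('v, 'k::comm_ring_1) mpoly set)"
proof
  let ?B = "{Var x * Var y | x y. {x, y} \<in> E} :: ('v, 'k) mpoly set"
  have Var_Var: "(Var x * Var y :: ('v, 'k) mpoly) = Poly_Mapping.single (vm x + vm y) 1" for x y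
    by (simp add: Var_def mult_single)
  have "Var x * Var y \<in> (monomial_ideal (graph_monomials E {}) :: ('v, 'k) mpoly set)" if "{x, y} \<in> E" for x y
  proof -
    have "\<forall>z\<in>{x, y}. 0 < Poly_Mapping.lookup (vm x + vm y) z"
      by (auto simp: lookup_add)
    then have "vm x + vm y \<in> graph_monomials E {}"
      using that unfolding graph_monomials_def by blast
    then show ?thesis
      unfolding Var_Var by (auto simp: monomial_ideal_def)
  qed
  then show "edge_ideal E \<subseteq> (monomial_ideal (graph_monomials E {}) :: ('v, 'k) mpoly set)"
    unfolding edge_ideal_def
    by (intro ideal_generated_subset_monomial_ideal up_closed_graph_monomials) blast
  show "monomial_ideal (graph_monomials E {}) \<subseteq> (edge_ideal E :: ('v, 'k) mpoly set)"
  proof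
    fix p :: "('v, 'k) mpoly" assume p: "p \<in> monomial_ideal (graph_monomials E {})"
    have "Poly_Mapping.single m c \<in> (Modules.module.span (*) ?B :: ('v, 'k) mpoly set)" if "m \<in> Poly_Mapping.keys p" for m c
    proof -
      have "m \<in> graph_monomials E {}"
        using p that by (auto simp: monomial_ideal_def)
      then obtain e where e: "e \<in> E" "\<forall>z\<in>e. 0 < Poly_Mapping.lookup m z"
        by (auto simp: graph_monomials_def)
      then obtain x y where xy: "e = {x, y}" "x \<noteq> y"
        using assms unfolding simple_graph_def card_2_iff by metis
      \<comment> \<open>As \<open>x\<close> and \<open>y\<close> are distinct, positive exponents at
        both give divisibility by the product.\<close>
      have "m - vm x - vm y + (vm x + vm y) = m"
        using e(2) xy
        by (intro poly_mapping_eqI) (auto simp: lookup_add lookup_minus lookup_single when_def)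
      then have "Poly_Mapping.single m c = Poly_Mapping.single (m - vm x - vm y) c * (Var x * Var y)"
        unfolding Var_Var mult_single by simp
      moreover have "Var x * Var y \<in> Modules.module.span (*) ?B"
        using e(1) xy(1) by (intro Modules.module.span_base[OF module_mult]) blast
      ultimately show ?thesis
        using Modules.module.span_scale[OF module_mult] by simp
    qed
    then have "(\<Sum>m\<in>Poly_Mapping.keys p. Poly_Mapping.single m (Poly_Mapping.lookup p m)) \<in> Modules.module.span (*) ?B"
      by (intro Modules.module.span_sum[OF module_mult])
    then show "p \<in> edge_ideal E"
      unfolding edge_ideal_def ideal_generated_def by (subst poly_mapping_eq_sum_single)
  qed
qed

text \<open>Induction on the number of edges with \<open>W\<close> and \<open>r\<close> arbitrary,
  because the colon step enlarges \<open>W\<close> and lowers \<open>r\<close>. Disjointness from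
  \<open>W\<close> ensures that the chosen \<open>x\<close>, which lies on an edge, is not an added
  variable.\<close>

lemma koszul_reg_le_graph_monomials:
  fixes E :: "'v::finite set set"
  assumes "simple_graph E" "\<Union>E \<inter> W = {}" "\<And>A. central_independent E A \<Longrightarrow> int (card A) \<le> r"
  shows "koszul_reg_le (monomial_ideal (graph_monomials E W) :: ('v, 'k::comm_ring_1) mpoly set) r"
  using assms
proof (induction "card E" arbitrary: E W r rule: less_induct)
  case less
  show ?case
  proof (cases "E = {}")
    case True
    have "0 \<le> r"
      using less.prems(3)[of "{}"] by (simp add: central_independent_def independent_set_def)
    then show ?thesis
      using koszul_reg_le_variables koszul_reg_le_mono True by blast
  next
    case False
    then obtain x where x: "central E x"
      using exists_central less.prems(1) by blast
    then obtain y where y: "{x, y} \<in> E"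
      using central_neighbors_nonempty by (force simp: neighbors_def)
    then have "x \<notin> W"
      using less.prems(2) by blast
    define N where "N = closed_nbhd E {x}"
    have N: "N = insert x (neighbors E x)"
      by (simp add: N_def closed_nbhd_def)
    have less_card: "card {e \<in> E. e \<inter> Z = {}} < card E" if "x \<in> Z" for Z
    proof (rule psubset_card_mono)
      have "{x, y} \<inter> Z \<noteq> {}"
        using that by blast
      then have "{x, y} \<notin> {e \<in> E. e \<inter> Z = {}}"
        by simp
      with y show "{e \<in> E. e \<inter> Z = {}} \<subset> E"
        by (metis (lifting) mem_Collect_eq psubsetI subsetI)
    qed simp
    have simple: "simple_graph {e \<in> E. e \<inter> Z = {}}" for Z
      using less.prems(1) by (simp add: simple_graph_def)
    have "koszul_reg_le (monomial_ideal (graph_monomials {e \<in> E. e \<inter> N = {}} (W \<union> neighbors E x)) :: ('v, 'k) mpoly set) (r - 1)"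
    proof (rule less.hyps[OF less_card simple])
      show "x \<in> N"
        by (simp add: N)
      show "\<Union>{e \<in> E. e \<inter> N = {}} \<inter> (W \<union> neighbors E x) = {}"
        using less.prems(2) by (auto simp: N)
      fix A assume "central_independent {e \<in> E. e \<inter> N = {}} A"
      then obtain B where B: "central_independent E B" "card B = card A" "B \<inter> N = {}"
        using central_independent_lift by blast
      \<comment> \<open>\<open>B\<close> avoids the closed neighbourhood of \<open>x\<close>, so
        there is room for \<open>x\<close>; this yields the bound \<open>r - 1\<close>.\<close>
      then have "central_independent E (insert x B)"
        using independent_set_insert[OF less.prems(1), of B x] x by (auto simp: central_independent_def N)
      moreover have "x \<notin> B"
        using B(3) by (auto simp: N)
      ultimately show "int (card A) \<le> r - 1"
        using less.prems(3)[of "insert x B"] B(2) by simp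
    qed
    moreover have "koszul_reg_le (monomial_ideal (graph_monomials {e \<in> E. e \<inter> {x} = {}} (insert x W)) :: ('v, 'k) mpoly set) r"
    proof (rule less.hyps[OF less_card simple])
      show "\<Union>{e \<in> E. e \<inter> {x} = {}} \<inter> insert x W = {}"
        using less.prems(2) by auto
      fix A assume "central_independent {e \<in> E. e \<inter> {x} = {}} A"
      then obtain B where "central_independent E B" "card B = card A"
        using central_independent_lift by blast
      then show "int (card A) \<le> r"
        using less.prems(3) by metis
    qed simp
    ultimately show ?thesis
      using koszul_reg_le_colon_plus[OF up_closed_graph_monomials[of E W], where x = x]
        colon_var_graph_monomials[OF less.prems(1) \<open>x \<notin> W\<close>] plus_var_graph_monomials[of E W x]
      by (simp add: N_def)
  qed
qed

subsection \<open>Degrees in minimal resolutions\<close>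

text \<open>A minimal resolution in coordinates: \<open>n q\<close> is the rank of the
  \<open>q\<close>-th module and \<open>\<beta> q\<close> lists its degrees. Equalities of kernel
  and image are split into complex and exactness conditions.\<close>

locale minimal_resolution =
  fixes n :: "nat \<Rightarrow> nat" and \<beta> :: "nat \<Rightarrow> nat \<Rightarrow> int"
    and \<epsilon> :: "nat \<Rightarrow> ('v::finite, 'k::comm_ring_1) mpoly"
    and D :: "nat \<Rightarrow> nat \<Rightarrow> nat \<Rightarrow> ('v, 'k) mpoly" and M :: "('v \<Rightarrow>\<^sub>0 nat) set"
  assumes up_closed: "up_closed M"
    and homogeneous_\<epsilon>: "t < n 0 \<Longrightarrow> homogeneous (\<beta> 0 t) (\<epsilon> t)"
    and homogeneous_D: "t < n q \<Longrightarrow> s < n (Suc q) \<Longrightarrow> homogeneous (\<beta> (Suc q) s - \<beta> q t) (D q t s)"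
    and surj_\<epsilon>: "\<exists>v. p - (\<Sum>t<n 0. \<epsilon> t * v t) \<in> monomial_ideal M"
    and complex_\<epsilon>: "s < n 1 \<Longrightarrow> (\<Sum>t<n 0. \<epsilon> t * D 0 t s) \<in> monomial_ideal M"
    and exact_\<epsilon>: "(\<Sum>t<n 0. \<epsilon> t * v t) \<in> monomial_ideal M \<Longrightarrow>
      \<exists>w. \<forall>t<n 0. v t = (\<Sum>s<n 1. D 0 t s * w s)"
    and complex_D: "t < n q \<Longrightarrow> s < n (Suc (Suc q)) \<Longrightarrow> (\<Sum>u<n (Suc q). D q t u * D (Suc q) u s) = 0"
    and exact_D: "(\<And>t. t < n q \<Longrightarrow> (\<Sum>u<n (Suc q). D q t u * v u) = 0) \<Longrightarrow>
      \<exists>w. \<forall>u<n (Suc q). v u = (\<Sum>s<n (Suc (Suc q)). D (Suc q) u s * w s)"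
    and minimal: "t < n q \<Longrightarrow> s < n (Suc q) \<Longrightarrow> Poly_Mapping.lookup (D q t s) 0 = 0"
begin

text \<open>In the double complex formed by the Koszul complex and the resolution, a zigzag leads from the
  \<open>s\<close>-th basis element of \<open>F\<^sub>i\<close>, in Koszul degree \<open>0\<close>, through \<open>K\<^sub>p \<otimes> F\<^sub>i\<^sub>-\<^sub>p\<close> to \<open>K\<^sub>i \<otimes> F\<^sub>0\<close>.\<close>

primrec zigzag :: "nat \<Rightarrow> nat \<Rightarrow> nat \<Rightarrow> nat \<Rightarrow> 'v set \<Rightarrow> ('v, 'k) mpoly" where
  "zigzag i s 0 t = (\<lambda>\<sigma>. if \<sigma> = {} \<and> t = s then 1 else 0)"
| "zigzag i s (Suc p) t = khom (\<lambda>\<sigma>. \<Sum>u<n (i - p). D (i - Suc p) t u * zigzag i s p u \<sigma>)"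

lemma kbd_zigzag_0: "kbd (zigzag i s 0 t) \<sigma> = 0"
  by (simp add: kbd_def)

text \<open>\<open>kbd_khom\<close> applies because the right-hand side is a cycle, by
  \<open>complex_D\<close> and the previous stage, and has no constant term, by minimality.\<close>

lemma kbd_zigzag:
  assumes "p < i" "t < n (i - Suc p)"
  shows "kbd (zigzag i s (Suc p) t) \<sigma> = (\<Sum>u<n (i - p). D (i - Suc p) t u * zigzag i s p u \<sigma>)"
  using assms
proof (induction p arbitrary: t \<sigma>)
  case 0
  have "kbd (\<lambda>\<sigma>. \<Sum>u<n i. D (i - Suc 0) t u * zigzag i s 0 u \<sigma>) \<sigma> = 0" for \<sigma>
    unfolding kbd_sum kbd_mult kbd_zigzag_0 by simp
  moreover have "Poly_Mapping.lookup (\<Sum>u<n i. D (i - Suc 0) t u * zigzag i s 0 u {}) 0 = 0"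
    using minimal[of t "i - 1"] 0 by (auto simp: lookup_sum intro!: sum.neutral)
  ultimately show ?case
    unfolding zigzag.simps(2) by (subst kbd_khom) simp_all
next
  case (Suc p)
  define q where "q = i - Suc (Suc p)"
  have i: "i - Suc p = Suc q" "i - p = Suc (Suc q)"
    using Suc.prems by (auto simp: q_def)
  have t: "t < n q"
    using Suc.prems by (simp add: q_def)
  let ?v = "\<lambda>\<sigma>. \<Sum>u<n (Suc q). D q t u * zigzag i s (Suc p) u \<sigma>"
  have "kbd ?v \<sigma> = 0" for \<sigma>
  proof -
    have "kbd ?v \<sigma> = (\<Sum>u<n (Suc q). D q t u * kbd (zigzag i s (Suc p) u) \<sigma>)"
      unfolding kbd_sum kbd_mult ..
    also have "\<dots> = (\<Sum>u<n (Suc q). D q t u * (\<Sum>u'<n (Suc (Suc q)). D (Suc q) u u' * zigzag i s p u' \<sigma>))"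
      using Suc.IH Suc.prems by (intro sum.cong refl) (simp only: i lessThan_iff Suc_lessD)
    also have "\<dots> = (\<Sum>u'<n (Suc (Suc q)). (\<Sum>u<n (Suc q). D q t u * D (Suc q) u u') * zigzag i s p u' \<sigma>)"
      unfolding sum_distrib_left sum_distrib_right by (subst sum.swap) (simp only: mult.assoc)
    also have "\<dots> = 0"
      using t by (intro sum.neutral) (simp add: complex_D)
    finally show ?thesis .
  qed
  moreover have "Poly_Mapping.lookup (?v {}) 0 = 0"
    unfolding lookup_sum
  proof (rule sum.neutral, rule ballI)
    fix u assume "u \<in> {..<n (Suc q)}"
    then show "Poly_Mapping.lookup (D q t u * zigzag i s (Suc p) u {}) 0 = 0"
      using minimal[of t q u] t nonconstant_mult[of "D q t u" "zigzag i s (Suc p) u {}"]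
      by (simp add: mult.commute)
  qed
  ultimately have "kbd (khom ?v) \<sigma> = ?v \<sigma>"
    by (rule kbd_khom)
  then show ?case
    unfolding zigzag.simps(2)[of i s "Suc p"] i q_def[symmetric] .
qed

text \<open>Stage \<open>p\<close> has total degree \<open>\<beta> i s\<close>; subtracting the
  degree of the basis element and the \<open>p\<close> exterior factors leaves the degree of the
  coefficient.\<close>

lemma homogeneous_zigzag:
  assumes "s < n i" "p \<le> i" "t < n (i - p)"
  shows "homogeneous (\<beta> i s - \<beta> (i - p) t - int p) (zigzag i s p t \<sigma>)"
  using assms(2,3)
proof (induction p arbitrary: t \<sigma>)
  case 0
  show ?case
    by (auto simp: homogeneous_def monomial_degree_def)
next
  case (Suc p)
  define q where "q = i - Suc p"
  have i: "i - p = Suc q" "i - Suc p = q"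
    using Suc.prems by (auto simp: q_def)
  let ?v = "\<lambda>\<sigma>. \<Sum>u<n (Suc q). D q t u * zigzag i s p u \<sigma>"
  have "homogeneous (\<beta> i s - \<beta> q t - int p) (?v \<sigma>)" for \<sigma>
  proof (rule homogeneous_sum)
    fix u assume u: "u \<in> {..<n (Suc q)}"
    have "homogeneous ((\<beta> (Suc q) u - \<beta> q t) + (\<beta> i s - \<beta> (Suc q) u - int p))
        (D q t u * zigzag i s p u \<sigma>)"
      using u Suc.prems Suc.IH[of u \<sigma>] by (intro homogeneous_mult homogeneous_D) (auto simp: i)
    then show "homogeneous (\<beta> i s - \<beta> q t - int p) (D q t u * zigzag i s p u \<sigma>)"
      by (simp add: algebra_simps)
  qed
  then have "homogeneous (\<beta> i s - \<beta> q t - int p - 1) (khom ?v \<sigma>)"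
    by (rule khom_homogeneous)
  then show ?case
    unfolding zigzag.simps i by (simp add: algebra_simps)
qed

lemma augmented_complex: "(\<Sum>t<n 0. \<epsilon> t * (\<Sum>s<n 1. D 0 t s * w s)) \<in> monomial_ideal M"
proof -
  have "(\<Sum>t<n 0. \<epsilon> t * (\<Sum>s<n 1. D 0 t s * w s)) = (\<Sum>s<n 1. w s * (\<Sum>t<n 0. \<epsilon> t * D 0 t s))"
    unfolding sum_distrib_left by (subst sum.swap) (simp only: mult_ac)
  also have "\<dots> \<in> monomial_ideal M"
    by (rule monomial_ideal_sum, rule monomial_ideal_mult[OF up_closed]) (simp add: complex_\<epsilon>)
  finally show ?thesis .
qed

text \<open>If the zigzag ends in a boundary modulo \<open>I\<close>, then tracing it back to its start (\<open>q = i\<close>) shows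
  that a basis element of \<open>F\<^sub>i\<close> has no constant coefficient.\<close>

lemma zigzag_back:
  assumes s: "s < n i"
    and boundary: "\<And>\<sigma>. (\<Sum>t<n 0. \<epsilon> t * zigzag i s i t \<sigma>) - kbd w \<sigma> \<in> monomial_ideal M"
    and "q \<le> i"
  shows "\<exists>y y'. \<forall>\<sigma>. \<forall>t<n q. zigzag i s (i - q) t \<sigma> =
    kbd (y t) \<sigma> + (\<Sum>u<n (Suc q). D q t u * y' u \<sigma>)"
  using assms(3)
proof (induction q)
  case 0
  \<comment> \<open>Lift \<open>w\<close> through the surjective augmentation, one face at a
    time.\<close>
  have "\<exists>v. \<forall>\<sigma>. w \<sigma> - (\<Sum>t<n 0. \<epsilon> t * v t \<sigma>) \<in> monomial_ideal M"
  proof -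
    have "\<exists>v. \<forall>\<sigma>. w \<sigma> - (\<Sum>t<n 0. \<epsilon> t * v \<sigma> t) \<in> monomial_ideal M"
      by (rule choice) (simp add: surj_\<epsilon>)
    then obtain v where "\<And>\<sigma>. w \<sigma> - (\<Sum>t<n 0. \<epsilon> t * v \<sigma> t) \<in> monomial_ideal M"
      by blast
    then show ?thesis
      by (intro exI[of _ "\<lambda>t \<sigma>. v \<sigma> t"]) simp
  qed
  then obtain v where v: "\<And>\<sigma>. w \<sigma> - (\<Sum>t<n 0. \<epsilon> t * v t \<sigma>) \<in> monomial_ideal M"
    by blast
  \<comment> \<open>After subtracting the boundary of the lift, the end of the zigzag is in the
    kernel of the augmentation.\<close>
  have "\<exists>y'. \<forall>t<n 0. zigzag i s i t \<sigma> - kbd (v t) \<sigma> = (\<Sum>u<n 1. D 0 t u * y' u)" for \<sigma>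
  proof (rule exact_\<epsilon>)
    have "kbd (\<lambda>\<sigma>. w \<sigma> - (\<Sum>t<n 0. \<epsilon> t * v t \<sigma>)) \<sigma> \<in> monomial_ideal M"
      by (rule kbd_monomial_ideal[OF up_closed v])
    then have "kbd w \<sigma> - (\<Sum>t<n 0. \<epsilon> t * kbd (v t) \<sigma>) \<in> monomial_ideal M"
      by (simp only: kbd_diff kbd_sum kbd_mult)
    from monomial_ideal_add[OF boundary[of \<sigma>] this]
    show "(\<Sum>t<n 0. \<epsilon> t * (zigzag i s i t \<sigma> - kbd (v t) \<sigma>)) \<in> monomial_ideal M"
      by (simp add: right_diff_distrib sum_subtractf)
  qed
  then obtain y' where "\<And>\<sigma> t. t < n 0 \<Longrightarrow> zigzag i s i t \<sigma> - kbd (v t) \<sigma> = (\<Sum>u<n 1. D 0 t u * y' \<sigma> u)"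
    by metis
  then show ?case
    by (intro exI[of _ v] exI[of _ "\<lambda>u \<sigma>. y' \<sigma> u"]) (auto simp: diff_eq_eq add.commute)
next
  case (Suc q)
  then obtain y y' where y: "\<And>\<sigma> t. t < n q \<Longrightarrow> zigzag i s (i - q) t \<sigma> =
      kbd (y t) \<sigma> + (\<Sum>u<n (Suc q). D q t u * y' u \<sigma>)"
    by fastforce
  define p where "p = i - Suc q"
  have p: "i - q = Suc p" "i - Suc p = q" "i - p = Suc q" "p < i"
    using Suc.prems by (auto simp: p_def)
  \<comment> \<open>Applying \<open>kbd\<close> to the relation at \<open>q\<close> shows that
    \<open>D q\<close> kills this difference, so exactness produces the next correction.\<close>
  have "\<exists>y''. \<forall>u<n (Suc q). zigzag i s p u \<sigma> - kbd (y' u) \<sigma> = (\<Sum>u'<n (Suc (Suc q)). D (Suc q) u u' * y'' u')" for \<sigma>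
  proof (rule exact_D)
    fix t assume t: "t < n q"
    have "(\<Sum>u<n (Suc q). D q t u * (zigzag i s p u \<sigma> - kbd (y' u) \<sigma>)) =
        (\<Sum>u<n (Suc q). D q t u * zigzag i s p u \<sigma>) - (\<Sum>u<n (Suc q). D q t u * kbd (y' u) \<sigma>)"
      by (simp add: right_diff_distrib sum_subtractf)
    also have "\<dots> = kbd (zigzag i s (Suc p) t) \<sigma> - kbd (\<lambda>\<sigma>. \<Sum>u<n (Suc q). D q t u * y' u \<sigma>) \<sigma>"
      using kbd_zigzag[OF p(4), of t s \<sigma>] t by (simp only: p kbd_sum kbd_mult)
    also have "\<dots> = kbd (\<lambda>\<sigma>. zigzag i s (Suc p) t \<sigma> - (\<Sum>u<n (Suc q). D q t u * y' u \<sigma>)) \<sigma>"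
      by (simp only: kbd_diff)
    also have "\<dots> = kbd (kbd (y t)) \<sigma>"
      using y[OF t] by (simp only: p add_diff_cancel_right')
    also have "\<dots> = 0"
      by (rule kbd_kbd)
    finally show "(\<Sum>u<n (Suc q). D q t u * (zigzag i s p u \<sigma> - kbd (y' u) \<sigma>)) = 0" .
  qed
  then obtain y'' where "\<And>\<sigma> u. u < n (Suc q) \<Longrightarrow>
      zigzag i s p u \<sigma> - kbd (y' u) \<sigma> = (\<Sum>u'<n (Suc (Suc q)). D (Suc q) u u' * y'' \<sigma> u')"
    by metis
  then show ?case
    unfolding p_def[symmetric]
    by (intro exI[of _ y'] exI[of _ "\<lambda>u \<sigma>. y'' \<sigma> u"]) (auto simp: diff_eq_eq add.commute)
qed

text \<open>Otherwise the end of the zigzag is a cycle modulo the ideal in a degree above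
  \<open>r\<close>, hence a boundary. Tracing back writes the coefficient 1 of a basis element as a
  sum of terms without constant part.\<close>

theorem degree_le_koszul_reg:
  assumes reg: "koszul_reg_le (monomial_ideal M :: ('v, 'k) mpoly set) r" and s: "s < n i"
  shows "\<beta> i s - int i \<le> r"
proof (rule ccontr)
  define z where "z \<sigma> = (\<Sum>t<n 0. \<epsilon> t * zigzag i s i t \<sigma>)" for \<sigma>
  assume "\<not> \<beta> i s - int i \<le> r"
  then have "r < \<beta> i s - int i"
    by simp
  moreover have "homogeneous (\<beta> i s - int i) (z \<sigma>)" for \<sigma>
    unfolding z_def
  proof (rule homogeneous_sum)
    fix t assume "t \<in> {..<n 0}"
    then have "homogeneous (\<beta> 0 t + (\<beta> i s - \<beta> 0 t - int i)) (\<epsilon> t * zigzag i s i t \<sigma>)"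
      using homogeneous_zigzag[OF s, of i t \<sigma>] by (intro homogeneous_mult homogeneous_\<epsilon>) auto
    then show "homogeneous (\<beta> i s - int i) (\<epsilon> t * zigzag i s i t \<sigma>)"
      by simp
  qed
  moreover have "kbd z \<sigma> \<in> monomial_ideal M" for \<sigma>
  proof -
    have "kbd z \<sigma> = (\<Sum>t<n 0. \<epsilon> t * kbd (zigzag i s i t) \<sigma>)"
      unfolding z_def kbd_sum kbd_mult ..
    also have "\<dots> \<in> monomial_ideal M"
    proof (cases i)
      case 0
      then show ?thesis
        by (simp only: kbd_zigzag_0) (simp add: monomial_ideal_0)
    next
      case (Suc p)
      then have "kbd (zigzag i s i t) \<sigma> = (\<Sum>u<n 1. D 0 t u * zigzag i s p u \<sigma>)" if "t < n 0" for t
        using kbd_zigzag[of p i t s \<sigma>] that by simp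
      then show ?thesis
        using augmented_complex[of "\<lambda>u. zigzag i s p u \<sigma>"] by simp
    qed
    finally show ?thesis .
  qed
  ultimately obtain w where "\<And>\<sigma>. z \<sigma> - kbd w \<sigma> \<in> monomial_ideal M"
    using koszul_reg_leE[OF reg, where z = z] by blast
  then obtain y y' where y: "\<And>\<sigma> t. t < n i \<Longrightarrow> zigzag i s 0 t \<sigma> =
      kbd (y t) \<sigma> + (\<Sum>u<n (Suc i). D i t u * y' u \<sigma>)"
    using zigzag_back[OF s, of w i] unfolding z_def by fastforce
  \<comment> \<open>By minimality the entries of \<open>D i\<close> have no constant term, and
    neither do their multiples.\<close>
  have "Poly_Mapping.lookup (\<Sum>u<n (Suc i). D i s u * y' u {}) 0 = 0"
    unfolding lookup_sum
  proof (rule sum.neutral, rule ballI)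
    fix u assume "u \<in> {..<n (Suc i)}"
    then show "Poly_Mapping.lookup (D i s u * y' u {}) 0 = 0"
      using minimal[of s i u] s nonconstant_mult[of "D i s u" "y' u {}"]
      by (simp add: mult.commute)
  qed
  then have "Poly_Mapping.lookup (zigzag i s 0 s {}) 0 = 0"
    unfolding y[OF s] lookup_add by simp
  then show False
    by simp
qed

end

section \<open>From matrices to coordinates\<close>

lemma mult_mat_vec_index_sum:
  assumes "A \<in> carrier_mat nr nc" "t < nr" "v \<in> carrier_vec nc"
  shows "(A *\<^sub>v v) $ t = (\<Sum>s<nc. A $$ (t, s) * v $ s)"
  using assms by (simp add: scalar_prod_def lessThan_atLeast0)

text \<open>Columns of \<open>D q\<close> are images of unit vectors, which gives the complex
  conditions; index functions packed by \<open>vec\<close> give the exactness conditions.\<close>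

lemma minimal_resolution_of_minimal_graded_free_resolution:
  fixes M :: "('v::finite \<Rightarrow>\<^sub>0 nat) set" and \<epsilon> :: "('v, 'k::field) mpoly vec"
  assumes M: "up_closed M"
    and res: "minimal_graded_free_resolution (monomial_ideal M) b \<epsilon> D"
  shows "minimal_resolution (\<lambda>q. length (b q)) (\<lambda>q t. b q ! t) (\<lambda>t. \<epsilon> $ t) (\<lambda>q t s. D q $$ (t, s)) M"
proof -
  let ?n = "\<lambda>q. length (b q)"
  note defs = minimal_graded_free_resolution_def graded_free_resolution_def
  have \<epsilon>: "\<epsilon> \<in> carrier_vec (?n 0)"
    and hom_\<epsilon>: "\<forall>s<?n 0. homogeneous (b 0 ! s) (\<epsilon> $ s)"
    and D: "\<forall>i. D i \<in> carrier_mat (?n i) (?n (Suc i))"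
    and hom_D: "\<forall>i. \<forall>t<?n i. \<forall>s<?n (Suc i). homogeneous (b (Suc i) ! s - b i ! t) (D i $$ (t, s))"
    and surj: "\<forall>p. \<exists>v\<in>carrier_vec (?n 0). p - \<epsilon> \<bullet> v \<in> monomial_ideal M"
    and exact_\<epsilon>: "{v \<in> carrier_vec (?n 0). \<epsilon> \<bullet> v \<in> monomial_ideal M} =
      (\<lambda>w. D 0 *\<^sub>v w) ` carrier_vec (?n 1)"
    and exact_D: "\<forall>i. mat_kernel (D i) = (\<lambda>w. D (Suc i) *\<^sub>v w) ` carrier_vec (?n (Suc (Suc i)))"
    and min: "\<forall>i. \<forall>t<?n i. \<forall>s<?n (Suc i). D i $$ (t, s) \<in> ideal_generated (range Var)"
    using res unfolding defs by - (elim conjE, assumption)+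
  note D = D[rule_format] and exact_D = exact_D[rule_format]
  have \<epsilon>_prod: "\<epsilon> \<bullet> v = (\<Sum>t<?n 0. \<epsilon> $ t * v $ t)" if "v \<in> carrier_vec (?n 0)" for v
    using that by (simp add: scalar_prod_def lessThan_atLeast0)
  have D_prod: "(D q *\<^sub>v v) $ t = (\<Sum>s<?n (Suc q). D q $$ (t, s) * v $ s)"
    if "t < ?n q" "v \<in> carrier_vec (?n (Suc q))" for q t v
    using mult_mat_vec_index_sum[OF D that] .
  have D_unit: "D q *\<^sub>v unit_vec (?n (Suc q)) s = col (D q) s" if "s < ?n (Suc q)" for q s
    using D[of q] that by (intro eq_vecI) (simp_all add: scalar_prod_right_unit)
  have D_col: "col (D q) s \<in> carrier_vec (?n q)" for q s
    using D[of q] by (metis carrier_matD(1) col_dim)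
  have D_col_index: "col (D q) s $ t = D q $$ (t, s)" if "t < ?n q" "s < ?n (Suc q)" for q s t
    using D[of q] that by simp
  show ?thesis
  proof
    show "up_closed M"
      by (rule M)
    show "homogeneous (b 0 ! t) (\<epsilon> $ t)" if "t < ?n 0" for t
      using hom_\<epsilon> that by blast
    show "homogeneous (b (Suc q) ! s - b q ! t) (D q $$ (t, s))" if "t < ?n q" "s < ?n (Suc q)" for t q s
      using hom_D that by blast
    show "\<exists>v. p - (\<Sum>t<?n 0. \<epsilon> $ t * v t) \<in> monomial_ideal M" for p
    proof -
      obtain v where v: "v \<in> carrier_vec (?n 0)" "p - \<epsilon> \<bullet> v \<in> monomial_ideal M"
        using surj by blast
      then show ?thesis
        by (intro exI[of _ "\<lambda>t. v $ t"]) (simp add: \<epsilon>_prod)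
    qed
    show "(\<Sum>t<?n 0. \<epsilon> $ t * D 0 $$ (t, s)) \<in> monomial_ideal M" if "s < ?n 1" for s
    proof -
      have "col (D 0) s \<in> (\<lambda>w. D 0 *\<^sub>v w) ` carrier_vec (?n 1)"
        using D_unit[of s 0] that by (metis One_nat_def imageI unit_vec_carrier)
      then have "\<epsilon> \<bullet> col (D 0) s \<in> monomial_ideal M"
        unfolding exact_\<epsilon>[symmetric] by simp
      then show ?thesis
        using \<epsilon>_prod[OF D_col, of s] D_col_index[of _ 0 s] that by simp
    qed
    show "\<exists>w. \<forall>t<?n 0. v t = (\<Sum>s<?n 1. D 0 $$ (t, s) * w s)"
      if "(\<Sum>t<?n 0. \<epsilon> $ t * v t) \<in> monomial_ideal M" for v
    proof -
      have "vec (?n 0) v \<in> {v \<in> carrier_vec (?n 0). \<epsilon> \<bullet> v \<in> monomial_ideal M}"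
        using that by (simp add: \<epsilon>_prod)
      then obtain w where w: "w \<in> carrier_vec (?n 1)" "vec (?n 0) v = D 0 *\<^sub>v w"
        unfolding exact_\<epsilon> by blast
      have "v t = (\<Sum>s<?n 1. D 0 $$ (t, s) * w $ s)" if "t < ?n 0" for t
        using D_prod[of t 0 w] w that by (metis One_nat_def index_vec)
      then show ?thesis
        by blast
    qed
    show "(\<Sum>u<?n (Suc q). D q $$ (t, u) * D (Suc q) $$ (u, s)) = 0"
      if "t < ?n q" "s < ?n (Suc (Suc q))" for t q s
    proof -
      have "col (D (Suc q)) s \<in> mat_kernel (D q)"
        unfolding exact_D using D_unit[of s "Suc q"] that(2) by (metis imageI unit_vec_carrier)
      then have "(D q *\<^sub>v col (D (Suc q)) s) $ t = 0"
        using mat_kernelD(2)[OF D] that(1) by (metis index_zero_vec(1))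
      then show ?thesis
        using D_prod[OF that(1) D_col, of s] D_col_index[of _ "Suc q" s] that(2) by simp
    qed
    show "\<exists>w. \<forall>u<?n (Suc q). v u = (\<Sum>s<?n (Suc (Suc q)). D (Suc q) $$ (u, s) * w s)"
      if "\<And>t. t < ?n q \<Longrightarrow> (\<Sum>u<?n (Suc q). D q $$ (t, u) * v u) = 0" for q v
    proof -
      have "D q *\<^sub>v vec (?n (Suc q)) v = 0\<^sub>v (?n q)"
      proof (rule eq_vecI)
        fix t assume "t < dim_vec (0\<^sub>v (?n q) :: ('v, 'k) mpoly vec)"
        then show "(D q *\<^sub>v vec (?n (Suc q)) v) $ t = 0\<^sub>v (?n q) $ t"
          using that[of t] D_prod[of t q "vec (?n (Suc q)) v"] by simp
      qed (use D[of q] in simp)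
      then have "vec (?n (Suc q)) v \<in> mat_kernel (D q)"
        by (intro mat_kernelI[OF D]) simp
      then obtain w where w: "w \<in> carrier_vec (?n (Suc (Suc q)))" "vec (?n (Suc q)) v = D (Suc q) *\<^sub>v w"
        unfolding exact_D by blast
      have "v u = (\<Sum>s<?n (Suc (Suc q)). D (Suc q) $$ (u, s) * w $ s)" if "u < ?n (Suc q)" for u
        using D_prod[of u "Suc q" w] w that by (metis index_vec)
      then show ?thesis
        by blast
    qed
    show "Poly_Mapping.lookup (D q $$ (t, s)) 0 = 0" if "t < ?n q" "s < ?n (Suc q)" for t q s
    proof -
      have "D q $$ (t, s) \<in> ideal_generated (range Var)"
        using min that by blast
      moreover have "range Var \<subseteq> (monomial_ideal (- {0}) :: ('v, 'k) mpoly set)"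
        by (auto simp: monomial_ideal_def Var_def simp flip: monomial_degree_0_iff)
      ultimately have "D q $$ (t, s) \<in> monomial_ideal (- {0})"
        using ideal_generated_subset_monomial_ideal[OF up_closed_nonconstant] by blast
      then show ?thesis
        by (auto simp: monomial_ideal_def in_keys_iff)
    qed
  qed
qed

theorem theorem1p6:
  fixes E :: "'v::finite set set"
  assumes "simple_graph E"
  shows "reg_quotient (edge_ideal E :: ('v, 'k::field) mpoly set) \<le> ereal (real (zeta E))"
  unfolding reg_quotient_def
proof (rule Sup_least)
  fix d assume "d \<in> {ereal (of_int (j - int i)) | i j. \<exists>b \<epsilon> D.
    minimal_graded_free_resolution (edge_ideal E :: ('v, 'k) mpoly set) b \<epsilon> D \<and> j \<in> set (b i)}"
  \<comment> \<open>The bound is proved for each basis degree of an arbitrary minimal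
    resolution.\<close>
  then obtain i s b \<epsilon> D where d: "d = ereal (of_int (b i ! s - int i))" and s: "s < length (b i)"
    and res: "minimal_graded_free_resolution (edge_ideal E :: ('v, 'k) mpoly set) b \<epsilon> D"
    by (auto simp: in_set_conv_nth)
  interpret minimal_resolution "\<lambda>q. length (b q)" "\<lambda>q t. b q ! t" "\<lambda>t. \<epsilon> $ t" "\<lambda>q t s. D q $$ (t, s)"
      "graph_monomials E {}"
    using res unfolding edge_ideal_eq_monomial_ideal[OF assms]
    by (rule minimal_resolution_of_minimal_graded_free_resolution[OF up_closed_graph_monomials])
  have "koszul_reg_le (monomial_ideal (graph_monomials E {}) :: ('v, 'k) mpoly set) (int (zeta E))"
    using card_central_independent_le_zeta assms
    by (intro koszul_reg_le_graph_monomials) auto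
  then have "b i ! s - int i \<le> int (zeta E)"
    using s by (rule degree_le_koszul_reg)
  then show "d \<le> ereal (real (zeta E))"
    unfolding d by simp
qed

end
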